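(* Assume the Böttcher case ($p_0=p_1=0$), that $\mathbf{E}e^{h|X_1|}<\infty$ for some $h>0$, and that $\varepsilon_n>0$ with $\varepsilon_n\to0$ and $\varepsilon_n^2m^n\to\infty$. Then \[ \mu\log\mathsf B\big(\varphi(1/(2\sigma^2))\big)\le\liminf_{n\to\infty}\varepsilon_n^{-2\beta}m^{-\beta n}\log\mathbf{P}(R_n\ge\varepsilon_n)\le\limsup_{n\to\infty}\varepsilon_n^{-2\beta}m^{-\beta n}\log\mathbf{P}(R_n\ge\varepsilon_n)\le\mu^{-1}\log\mathsf B\big(\varphi(1/(2\sigma^2))\big). \] If additionally $\varepsilon_n=m^{-\lambda_n/2}$ for integers $\lambda_n\to\infty$ with $\lambda_n=o(n)$, then \[\lim_{n\to\infty}\varepsilon_n^{-2\beta}m^{-\beta n}\log\mathbf{P}(R_n\ge\varepsilon_n)=\log\mathsf B\big(\varphi(1/(2\sigma^2))\big).\]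
   Context: Standing setup: $Z=(Z_n)_{n\ge0}$ is a Galton–Watson process with $Z_0=1$ and offspring law $\{p_k\}$ with mean $m\in(1,\infty)$ and $\mathbf{E}Z_1\log Z_1<\infty$. Independently, $(X_n)$ are i.i.d. with $\mathbf{E}X_1=0$, $\sigma^2:=\mathbf{E}X_1^2\in(0,\infty)$; $S_k:=X_1+\dots+X_k$; $R_n:=S_{Z_n}/Z_n$ on $\{Z_n>0\}$, and $\mathbf{P}(R_n\ge x)$ means $\mathbf{P}(R_n\ge x, Z_n>0)$. Böttcher case: $p_0+p_1=0$; then $\mu:=\min\{k:p_k>0\}\ge2$ and the Böttcher constant $\beta\in(0,1)$ is defined by $\mu=m^\beta$. $f$ is the offspring generating function, $f_n$ its $n$-th iterate, and $\mathsf B(s):=\lim_{n\to\infty}(f_n(s))^{\mu^{-n}}$, $0\le s\le1$ (this limit exists, is positive and continuous). $W:=\lim_nm^{-n}Z_n$ a.s. and $\varphi(h):=\mathbf{E}e^{-hW}$. *)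

theory Defs
  imports "HOL-Probability.Probability"
begin

fun GW_pop :: "(nat \<Rightarrow> nat \<Rightarrow> 'a \<Rightarrow> nat) \<Rightarrow> nat \<Rightarrow> 'a \<Rightarrow> nat" where
  "GW_pop xi 0 \<omega> = 1"
| "GW_pop xi (Suc n) \<omega> = (\<Sum>i<GW_pop xi n \<omega>. xi n i \<omega>)"

definition offspring_gf :: "nat pmf \<Rightarrow> real \<Rightarrow> real" where
  "offspring_gf p s = measure_pmf.expectation p (\<lambda>k. s ^ k)"

definition offspring_mean :: "nat pmf \<Rightarrow> real" where
  "offspring_mean p = measure_pmf.expectation p real"

definition boettcher_index :: "nat pmf \<Rightarrow> nat" where
  "boettcher_index p = (LEAST k. pmf p k > 0)"

text \<open>beta with mu = m^beta\<close>
definition boettcher_const :: "nat pmf \<Rightarrow> real" where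
  "boettcher_const p = ln (real (boettcher_index p)) / ln (offspring_mean p)"

definition boettcher_B :: "nat pmf \<Rightarrow> real \<Rightarrow> real" where
  "boettcher_B p s = lim (\<lambda>n. ((offspring_gf p ^^ n) s) powr (1 / real (boettcher_index p) ^ n))"

text \<open>S_k = X_1 + ... + X_k, with X_1, X_2, ... stored as X 0, X 1, ...\<close>
definition partial_sum :: "(nat \<Rightarrow> 'a \<Rightarrow> real) \<Rightarrow> nat \<Rightarrow> 'a \<Rightarrow> real" where
  "partial_sum X k \<omega> = (\<Sum>i<k. X i \<omega>)"

text \<open>W = lim m^(-n) Z_n (a.s. limit; the limsup agrees with it wherever the limit exists)\<close>
definition GW_limit :: "(nat \<Rightarrow> nat \<Rightarrow> 'a \<Rightarrow> nat) \<Rightarrow> real \<Rightarrow> 'a \<Rightarrow> real" where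
  "GW_limit xi m \<omega> = real_of_ereal (limsup (\<lambda>n. ereal (real (GW_pop xi n \<omega>) / m ^ n)))"

definition R_tail :: "'a measure \<Rightarrow> (nat \<Rightarrow> nat \<Rightarrow> 'a \<Rightarrow> nat) \<Rightarrow> (nat \<Rightarrow> 'a \<Rightarrow> real) \<Rightarrow> nat \<Rightarrow> real \<Rightarrow> real" where
  "R_tail M xi X n x = measure M {\<omega> \<in> space M. GW_pop xi n \<omega> > 0 \<and>
      partial_sum X (GW_pop xi n \<omega>) \<omega> / real (GW_pop xi n \<omega>) \<ge> x}"

end

theory Submission
  imports Defs "HOL-Real_Asymp.Real_Asymp"
begin

text \<open>Conditioning on \<open>Z\<^sub>n\<close>, the tail probability is the mean of \<open>P(S\<^sub>k \<ge> k \<epsilon>\<^sub>n)\<close> at \<open>k = Z\<^sub>n\<close>. Chernoff's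
  bound and a block argument based on the central limit theorem show that this probability is
  \<open>exp (-(1 + o(1)) k \<epsilon>\<^sub>n\<^sup>2 / (2 \<sigma>\<^sup>2))\<close> up to a constant factor, so the tail is squeezed between
  multiples of \<open>f\<^sub>n(exp (-\<theta> \<epsilon>\<^sub>n\<^sup>2))\<close> with \<open>\<theta>\<close> close to \<open>1 / (2 \<sigma>\<^sup>2)\<close>. If \<open>m\<^sup>-\<^sup>j \<approx> \<epsilon>\<^sub>n\<^sup>2\<close>, then
  \<open>f\<^sub>n = f\<^sub>n\<^sub>-\<^sub>j \<circ> f\<^sub>j\<close>, the inner iterate tends to the Laplace transform of \<open>W\<close> because \<open>Z\<^sub>j / m\<^sup>j\<close> is a
  convergent martingale, and \<open>\<mu>\<^sup>-\<^sup>k log f\<^sub>k\<close> tends to \<open>log B\<close> uniformly on \<open>(0, 1]\<close>.\<close>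

section \<open>The Boettcher function\<close>

text \<open>Since \<open>m powr \<beta> = \<mu>\<close>, the normalisation
  \<open>((\<epsilon> n)\<^sup>2 * m ^ n) powr \<beta>\<close> is exactly
  \<open>\<mu> ^ (n - j)\<close> when \<open>(\<epsilon> n)\<^sup>2 = 1 / m ^ j\<close> and
  \<open>j \<le> n\<close>. This gives a true limit along powers of \<open>m\<close>; in general,
  rounding to such a power loses up to a factor \<open>\<mu>\<close> on either side. Constant
  factors in the tail disappear because the normalisation tends to infinity. A factor
  \<open>1 \<plusminus> \<delta>\<close> in the exponent does not: it moves the argument of the
  Laplace transform, and is removed only at the end, by letting \<open>\<delta>\<close> tend to 0
  and using the continuity of that transform and of \<open>ln B\<close>. The walk is the delicate
  part. \<open>Z n\<close> is random while \<open>\<epsilon> n\<close> tends to 0, so the walk must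
  be estimated uniformly over all lengths above a fixed threshold. Neither the central limit theorem
  nor a large deviation principle at a fixed level gives this by itself.\<close>

locale boettcher_offspring =
  fixes p :: "nat pmf"
  assumes pmf_0: "pmf p 0 = 0" and pmf_1: "pmf p 1 = 0"
begin

abbreviation "f \<equiv> offspring_gf p"
abbreviation "\<mu> \<equiv> boettcher_index p"

lemma pmf_index_pos: "pmf p \<mu> > 0"
proof -
  obtain k where "k \<in> set_pmf p" using set_pmf_not_empty[of p] by blast
  hence "pmf p k > 0" by (simp add: pmf_positive)
  thus ?thesis unfolding boettcher_index_def by (rule LeastI)
qed

lemma index_le: "k \<in> set_pmf p \<Longrightarrow> \<mu> \<le> k"
  unfolding boettcher_index_def by (rule Least_le) (simp add: pmf_positive)

lemma index_ge_2: "2 \<le> \<mu>"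
proof -
  have "\<mu> \<noteq> 0" "\<mu> \<noteq> 1" using pmf_index_pos pmf_0 pmf_1 by (metis less_irrefl)+
  thus ?thesis by simp
qed

lemma integrable_gf: "0 \<le> s \<Longrightarrow> s \<le> 1 \<Longrightarrow> integrable (measure_pmf p) (\<lambda>k. s ^ k :: real)"
  by (rule measure_pmf.integrable_const_bound[where B=1]) (auto simp: power_le_one)

lemma gf_le: assumes "0 \<le> s" "s \<le> 1" shows "f s \<le> s ^ \<mu>"
proof -
  have "f s \<le> measure_pmf.expectation p (\<lambda>k. s ^ \<mu>)" unfolding offspring_gf_def
    using assms
    by (intro integral_mono_AE integrable_gf)
       (auto simp: AE_measure_pmf_iff intro!: power_decreasing index_le)
  thus ?thesis by simp
qed

text \<open>Only the lowest term of the power series is kept. With \<open>gf_le\<close> this gives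
  \<open>ln (f s) = \<mu> * ln s + O(1)\<close> uniformly on \<open>(0, 1]\<close>, from which the
  Boettcher estimates follow.\<close>

lemma gf_ge: assumes "0 \<le> s" "s \<le> 1" shows "pmf p \<mu> * s ^ \<mu> \<le> f s"
proof -
  have "pmf p \<mu> * s ^ \<mu> = measure_pmf.expectation p (\<lambda>k. indicator {\<mu>} k * s ^ \<mu>)"
    by (simp add: measure_pmf_single)
  also have "\<dots> \<le> f s" unfolding offspring_gf_def using assms
    by (intro integral_mono integrable_gf measure_pmf.integrable_const_bound[where B=1])
       (auto simp: indicator_def power_le_one)
  finally show ?thesis .
qed

lemma gf_mono: "0 \<le> s \<Longrightarrow> s \<le> t \<Longrightarrow> t \<le> 1 \<Longrightarrow> f s \<le> f t"
  unfolding offspring_gf_def by (intro integral_mono integrable_gf power_mono) auto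

lemma gf_in: assumes "s \<in> {0<..1}" shows "f s \<in> {0<..1}"
proof -
  have "0 < pmf p \<mu> * s ^ \<mu>" using assms pmf_index_pos by simp
  moreover have "s ^ \<mu> \<le> 1" using assms by (simp add: power_le_one)
  ultimately show ?thesis using gf_le[of s] gf_ge[of s] assms by auto
qed

lemma gf_continuous: "continuous_on {0<..1} f"
proof (unfold continuous_on_sequentially, intro allI ballI impI)
  fix x :: "nat \<Rightarrow> real" and s assume s: "s \<in> {0<..1}" and x: "(\<forall>n. x n \<in> {0<..1}) \<and> x \<longlonglongrightarrow> s"
  have "(\<lambda>n. measure_pmf.expectation p (\<lambda>k. x n ^ k)) \<longlonglongrightarrow> measure_pmf.expectation p (\<lambda>k. s ^ k)"
    by (rule integral_dominated_convergence[where w="\<lambda>_. 1"])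
       (use x s in \<open>auto intro!: tendsto_power power_le_one simp: less_imp_le\<close>)
  thus "(f \<circ> x) \<longlonglongrightarrow> f s" by (simp add: offspring_gf_def[abs_def] o_def)
qed

lemma iterate_in: "s \<in> {0<..1} \<Longrightarrow> (f ^^ n) s \<in> {0<..1}"
  by (induction n) (auto dest: gf_in simp del: greaterThanAtMost_iff)

lemma iterate_mono:
  assumes "0 < s" "s \<le> t" "t \<le> 1" shows "(f ^^ n) s \<le> (f ^^ n) t"
proof (induction n)
  case (Suc n)
  have "(f ^^ n) s \<in> {0<..1}" "(f ^^ n) t \<in> {0<..1}" using assms by (auto intro!: iterate_in simp del: greaterThanAtMost_iff) auto
  thus ?case using Suc by (auto intro!: gf_mono)
qed (use assms in simp)

lemma iterate_continuous: "continuous_on {0<..1} (f ^^ n)"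
proof (induction n)
  case (Suc n)
  have "continuous_on {0<..1} (\<lambda>s. f ((f ^^ n) s))"
    by (rule continuous_on_compose2[OF gf_continuous Suc]) (use iterate_in in blast)
  thus ?case by (simp add: o_def)
qed (simp add: id_def)

text \<open>The logarithm of the expression whose limit is \<open>boettcher_B\<close>. In this form
  another application of \<open>f\<close> costs only a bounded amount divided by
  \<open>\<mu> ^ Suc n\<close>.\<close>

definition log_iterate :: "nat \<Rightarrow> real \<Rightarrow> real" where
  "log_iterate n s = ln ((f ^^ n) s) / real \<mu> ^ n"

lemma log_iterate_Suc:
  assumes s: "s \<in> {0<..1}"
  shows "log_iterate (Suc n) s \<le> log_iterate n s"
    and "log_iterate n s + ln (pmf p \<mu>) / real \<mu> ^ Suc n \<le> log_iterate (Suc n) s"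
proof -
  define t where "t = (f ^^ n) s"
  have t: "0 < t" "t \<le> 1" using iterate_in[OF s, of n] by (auto simp: t_def)
  have ft: "0 < f t" using gf_in[of t] t by auto
  have mu: "real \<mu> > 0" using index_ge_2 by simp
  have "ln (f t) \<le> ln (t ^ \<mu>)" using gf_le[of t] t ft by (subst ln_le_cancel_iff) auto
  hence u: "ln (f t) \<le> real \<mu> * ln t" using t by (simp add: ln_realpow)
  have "ln (pmf p \<mu> * t ^ \<mu>) \<le> ln (f t)" using gf_ge[of t] t ft pmf_index_pos
    by (subst ln_le_cancel_iff) auto
  hence l: "ln (pmf p \<mu>) + real \<mu> * ln t \<le> ln (f t)"
    using t pmf_index_pos by (simp add: ln_mult ln_realpow)
  have e: "log_iterate (Suc n) s = ln (f t) / real \<mu> ^ Suc n"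
     "log_iterate n s = real \<mu> * ln t / real \<mu> ^ Suc n"
    using mu by (simp_all add: log_iterate_def t_def)
  show "log_iterate (Suc n) s \<le> log_iterate n s" unfolding e
    by (rule divide_right_mono[OF u]) simp
  show "log_iterate n s + ln (pmf p \<mu>) / real \<mu> ^ Suc n \<le> log_iterate (Suc n) s"
    unfolding e add_divide_distrib[symmetric] using l by (intro divide_right_mono) auto
qed

text \<open>The sequence decreases, and after adding the correction
  \<open>ln (pmf p \<mu>) / \<mu> ^ n\<close> it increases. The correction vanishes, so both have
  the same limit, which lies between them at every \<open>n\<close>.\<close>

lemma log_iterate_bounds:
  assumes s: "s \<in> {0<..1}"
  shows "ln (boettcher_B p s) \<le> log_iterate n s"
    and "log_iterate n s + ln (pmf p \<mu>) / real \<mu> ^ n \<le> ln (boettcher_B p s)"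
    and "(\<lambda>n. log_iterate n s) \<longlonglongrightarrow> ln (boettcher_B p s)"
proof -
  let ?u = "\<lambda>n. log_iterate n s + ln (pmf p \<mu>) / real \<mu> ^ n"
  have mu: "real \<mu> \<ge> 2" using index_ge_2 by simp
  have lnp: "ln (pmf p \<mu>) \<le> 0" using pmf_index_pos pmf_le_1[of p \<mu>] by simp
  have dec: "decseq (\<lambda>n. log_iterate n s)"
    using log_iterate_Suc(1)[OF s] by (intro decseq_SucI)
  have inc: "incseq ?u"
  proof (rule incseq_SucI)
    fix n
    \<comment> \<open>Since \<open>\<mu> \<ge> 2\<close>, the correction at \<open>n\<close> is at
      least twice the one at \<open>Suc n\<close> in absolute value: one copy pays for the step, the
      other is the next correction.\<close>
    have "ln (pmf p \<mu>) / real \<mu> ^ n = real \<mu> * (ln (pmf p \<mu>) / real \<mu> ^ Suc n)" using mu by simp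
    also have "\<dots> \<le> 2 * (ln (pmf p \<mu>) / real \<mu> ^ Suc n)"
      using mu lnp by (intro mult_right_mono_neg) (auto intro!: divide_nonpos_nonneg)
    finally show "?u n \<le> ?u (Suc n)" using log_iterate_Suc(2)[OF s, of n] by linarith
  qed
  have lo: "?u 0 \<le> log_iterate n s" for n
  proof -
    have "ln (pmf p \<mu>) / real \<mu> ^ n \<le> 0" using lnp by (intro divide_nonpos_nonneg) auto
    with incseqD[OF inc, of 0 n] show ?thesis by simp
  qed
  from decseq_convergent[OF dec, of "?u 0"] lo
  obtain G where G: "(\<lambda>n. log_iterate n s) \<longlonglongrightarrow> G" "\<And>n. G \<le> log_iterate n s" by blast
  have "(\<lambda>n. (f ^^ n) s powr (1 / real \<mu> ^ n)) = (\<lambda>n. exp (log_iterate n s))"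
  proof
    fix n show "(f ^^ n) s powr (1 / real \<mu> ^ n) = exp (log_iterate n s)"
      using iterate_in[OF s, of n] by (simp add: powr_def log_iterate_def)
  qed
  hence "(\<lambda>n. (f ^^ n) s powr (1 / real \<mu> ^ n)) \<longlonglongrightarrow> exp G"
    using G(1) by (auto intro: tendsto_intros)
  hence B: "ln (boettcher_B p s) = G" unfolding boettcher_B_def by (simp add: limI)
  show "ln (boettcher_B p s) \<le> log_iterate n s" using G B by simp
  show "(\<lambda>n. log_iterate n s) \<longlonglongrightarrow> ln (boettcher_B p s)" using G B by simp
  have "(\<lambda>n. ln (pmf p \<mu>) / real \<mu> ^ n) \<longlonglongrightarrow> 0"
    using mu by (intro LIMSEQ_divide_realpow_zero) simp
  from tendsto_add[OF G(1) this] have "?u \<longlonglongrightarrow> G" by simp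
  from incseq_le[OF inc this, of n] show "?u n \<le> ln (boettcher_B p s)" using B by simp
qed

lemma log_iterate_dist:
  assumes s: "s \<in> {0<..1}"
  shows "\<bar>log_iterate n s - ln (boettcher_B p s)\<bar> \<le> - ln (pmf p \<mu>) / real \<mu> ^ n"
  using log_iterate_bounds(1,2)[OF s, of n] by simp

lemma log_iterate_error_tendsto: "(\<lambda>n. - ln (pmf p \<mu>) / real \<mu> ^ n) \<longlonglongrightarrow> 0"
  using index_ge_2 by (intro LIMSEQ_divide_realpow_zero) simp

lemma ln_boettcher_continuous: "continuous_on {0<..1} (\<lambda>s. ln (boettcher_B p s))"
proof (rule uniform_limit_theorem[where F=sequentially])
  show "\<forall>\<^sub>F n in sequentially. continuous_on {0<..1} (log_iterate n)"
  proof (intro always_eventually allI)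
    fix n show "continuous_on {0<..1} (log_iterate n)" unfolding log_iterate_def
      using iterate_in[of _ n] index_ge_2 by (intro continuous_intros iterate_continuous) force+
  qed
  show "uniform_limit {0<..1} log_iterate (\<lambda>s. ln (boettcher_B p s)) sequentially"
  proof (rule uniform_limitI)
    fix e :: real assume "e > 0"
    from order_tendstoD(2)[OF log_iterate_error_tendsto this]
    show "\<forall>\<^sub>F n in sequentially. \<forall>x\<in>{0<..1}. dist (log_iterate n x) (ln (boettcher_B p x)) < e"
      by eventually_elim (auto simp: dist_real_def intro: le_less_trans[OF log_iterate_dist])
  qed
qed simp

text \<open>Index and argument move together, so pointwise convergence would not do. The error in
  \<open>log_iterate_dist\<close> does not depend on \<open>s\<close>, and continuity of
  \<open>ln B\<close> takes care of the moving argument.\<close>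

lemma log_iterate_tendsto_diagonal:
  assumes k: "filterlim k at_top sequentially" and s: "s \<longlonglongrightarrow> t"
    and s_in: "\<And>n. s n \<in> {0<..1}" and t: "t \<in> {0<..1}"
  shows "(\<lambda>n. log_iterate (k n) (s n)) \<longlonglongrightarrow> ln (boettcher_B p t)"
proof -
  have 1: "(\<lambda>n. ln (boettcher_B p (s n))) \<longlonglongrightarrow> ln (boettcher_B p t)"
    by (rule continuous_on_tendsto_compose[OF ln_boettcher_continuous s t]) (use s_in in auto)
  have "(\<lambda>n. log_iterate (k n) (s n) - ln (boettcher_B p (s n))) \<longlonglongrightarrow> 0"
    by (rule Lim_null_comparison[OF _ filterlim_compose[OF log_iterate_error_tendsto k]])
       (use log_iterate_dist[OF s_in] in auto)
  from tendsto_add[OF this 1] show ?thesis by simp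
qed

text \<open>Boettcher's functional equation \<open>B (f s) = B s ^ \<mu>\<close> in logarithmic
  form. Combined with \<open>laplace_scale\<close>, it turns a rescaling of \<open>\<theta>\<close>
  by \<open>m\<close> into a factor \<open>\<mu>\<close>.\<close>

lemma ln_boettcher_gf:
  assumes s: "s \<in> {0<..1}"
  shows "ln (boettcher_B p (f s)) = real \<mu> * ln (boettcher_B p s)"
proof -
  have "log_iterate n (f s) = real \<mu> * log_iterate (Suc n) s" for n
    using index_ge_2 by (simp add: log_iterate_def funpow_swap1)
  moreover have "(\<lambda>n. real \<mu> * log_iterate (Suc n) s) \<longlonglongrightarrow> real \<mu> * ln (boettcher_B p s)"
    by (intro tendsto_intros LIMSEQ_Suc[OF log_iterate_bounds(3)[OF s]])
  ultimately show ?thesis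
    using LIMSEQ_unique[OF log_iterate_bounds(3)[OF gf_in[OF s]]] by simp
qed

end

section \<open>Iterates at the critical scale\<close>

lemma filterlim_at_top_of_real:
  "filterlim (\<lambda>n. real (g n)) at_top F \<Longrightarrow> filterlim g at_top F"
  unfolding filterlim_at_top by (auto dest: spec[of _ "real _"])

text \<open>\<open>\<Phi>\<close> stands for the Laplace transform of \<open>W\<close>. Only its
  range and the convergence of iterates towards it enter, so this section is purely
  analytic.\<close>

locale boettcher_limit = boettcher_offspring +
  fixes \<Phi> :: "real \<Rightarrow> real"
  assumes mean_gt_1: "1 < offspring_mean p"
    and laplace_lim: "\<theta> > 0 \<Longrightarrow> (\<lambda>j. (f ^^ j) (exp (- \<theta> / offspring_mean p ^ j))) \<longlonglongrightarrow> \<Phi> \<theta>"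
    and laplace_in: "\<theta> > 0 \<Longrightarrow> \<Phi> \<theta> \<in> {0<..1}"
begin

abbreviation "m \<equiv> offspring_mean p"
abbreviation "\<beta> \<equiv> boettcher_const p"

lemma exp_in: "\<theta> > 0 \<Longrightarrow> exp (- \<theta> / m ^ j) \<in> {0<..1}" "0 \<le> x \<Longrightarrow> exp (- x) \<in> {0<..1::real}"
  using mean_gt_1 by auto

lemma power_mean_powr: "(m ^ k) powr \<beta> = real \<mu> ^ k"
proof -
  have "(m ^ k) powr \<beta> = exp (real k * (\<beta> * ln m))"
    using mean_gt_1 by (simp add: powr_def ln_realpow)
  also have "\<beta> * ln m = ln (real \<mu>)" using mean_gt_1 by (simp add: boettcher_const_def)
  also have "exp (real k * ln (real \<mu>)) = real \<mu> ^ k"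
    using index_ge_2 by (simp add: exp_of_nat_mult)
  finally show ?thesis .
qed

lemma boettcher_const_pos: "0 < \<beta>"
  using mean_gt_1 index_ge_2 by (simp add: boettcher_const_def)

text \<open>The Poincare equation of the Laplace transform: as
  \<open>m * \<theta> / m ^ Suc j = \<theta> / m ^ j\<close>, one more generation at parameter
  \<open>m * \<theta>\<close> amounts to one more application of \<open>f\<close>.\<close>

lemma laplace_scale:
  assumes "\<theta> > 0" shows "\<Phi> (m * \<theta>) = f (\<Phi> \<theta>)"
proof -
  have "(\<lambda>j. f ((f ^^ j) (exp (- \<theta> / m ^ j)))) \<longlonglongrightarrow> f (\<Phi> \<theta>)"
    by (rule continuous_on_tendsto_compose[OF gf_continuous laplace_lim[OF assms] laplace_in[OF assms]])
       (intro always_eventually allI iterate_in exp_in assms)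
  moreover have "(\<lambda>j. (f ^^ Suc j) (exp (- (m * \<theta>) / m ^ Suc j))) \<longlonglongrightarrow> \<Phi> (m * \<theta>)"
    by (rule LIMSEQ_Suc[OF laplace_lim]) (use assms mean_gt_1 in simp)
  moreover have "(f ^^ Suc j) (exp (- (m * \<theta>) / m ^ Suc j)) = f ((f ^^ j) (exp (- \<theta> / m ^ j)))" for j
    using mean_gt_1 by simp
  ultimately show ?thesis using LIMSEQ_unique by fastforce
qed

text \<open>With \<open>(\<epsilon> n)\<^sup>2\<close> for \<open>a n\<close>, the denominator is
  the normalisation of the theorem, and the numerator is what the tail is compared with.\<close>

definition normalized_log_gf :: "real \<Rightarrow> (nat \<Rightarrow> real) \<Rightarrow> nat \<Rightarrow> real" where
  "normalized_log_gf \<theta> a n = ln ((f ^^ n) (exp (- \<theta> * a n))) / (a n * m ^ n) powr \<beta>"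

lemma log_iterate_split:
  "k \<le> n \<Longrightarrow> log_iterate (n - k) ((f ^^ k) s) = ln ((f ^^ n) s) / real \<mu> ^ (n - k)"
  unfolding log_iterate_def by (simp flip: funpow_add[unfolded o_def, THEN fun_cong])

lemma log_iterate_split_limit:
  assumes "\<theta> > 0" "filterlim j at_top sequentially" "filterlim (\<lambda>n. n - j n) at_top sequentially"
  shows "(\<lambda>n. log_iterate (n - j n) ((f ^^ j n) (exp (- \<theta> / m ^ j n)))) \<longlonglongrightarrow> ln (boettcher_B p (\<Phi> \<theta>))"
  using assms
  by (intro log_iterate_tendsto_diagonal filterlim_compose[OF laplace_lim] iterate_in exp_in laplace_in)

lemma normalized_log_gf_limit:
  assumes \<theta>: "\<theta> > 0" and j: "filterlim j at_top sequentially" "filterlim (\<lambda>n. n - j n) at_top sequentially"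
    and a: "\<forall>\<^sub>F n in sequentially. a n = 1 / m ^ j n"
  shows "normalized_log_gf \<theta> a \<longlonglongrightarrow> ln (boettcher_B p (\<Phi> \<theta>))"
proof (rule Lim_transform_eventually[OF log_iterate_split_limit[OF \<theta> j]])
  \<comment> \<open>Subtraction on \<open>nat\<close> is truncated; \<open>1 \<le> n - j n\<close>
    is how \<open>j n \<le> n\<close> is obtained.\<close>
  from j(2) have "\<forall>\<^sub>F n in sequentially. 1 \<le> n - j n" by (simp add: filterlim_at_top)
  with a show "\<forall>\<^sub>F n in sequentially.
    log_iterate (n - j n) ((f ^^ j n) (exp (- \<theta> / m ^ j n))) = normalized_log_gf \<theta> a n"
  proof eventually_elim
    case (elim n)
    hence "j n \<le> n" by simp
    have "a n * m ^ n = m ^ (n - j n)" using \<open>j n \<le> n\<close> elim mean_gt_1 by (simp add: power_diff)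
    thus ?case using elim \<open>j n \<le> n\<close>
      by (simp add: normalized_log_gf_def log_iterate_split power_mean_powr)
  qed
qed

text \<open>With \<open>m\<^sup>-\<^sup>j \<le> a n < m\<^sup>1\<^sup>-\<^sup>j\<close> the iterate splits as \<open>f\<^sub>n = f\<^sub>n\<^sub>-\<^sub>j \<circ> f\<^sub>j\<close>; rounding \<open>a n\<close> to a
  power of \<open>m\<close> costs a factor between \<open>1\<close> and \<open>\<mu>\<close> in the normalisation and in the exponent.\<close>
lemma normalized_log_gf_bounds:
  assumes \<theta>: "\<theta> > 0" and pos: "\<And>n. a n > 0" and a0: "a \<longlonglongrightarrow> 0"
    and ainf: "filterlim (\<lambda>n. a n * m ^ n) at_top sequentially"
  obtains x y where "y \<longlonglongrightarrow> real \<mu> * ln (boettcher_B p (\<Phi> \<theta>))" "x \<longlonglongrightarrow> ln (boettcher_B p (\<Phi> \<theta>)) / real \<mu>"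
    "\<forall>\<^sub>F n in sequentially. y n \<le> normalized_log_gf \<theta> a n"
    "\<forall>\<^sub>F n in sequentially. normalized_log_gf \<theta> a n \<le> x n"
proof -
  \<comment> \<open>For \<open>a n \<le> 1\<close> this is the least \<open>j\<close> with
    \<open>1 / m ^ j \<le> a n\<close>. Hence the lower estimate for \<open>j\<close> always holds,
    the upper one only eventually.\<close>
  define j where "j n = nat \<lceil>- log m (a n)\<rceil>" for n
  have lim_log: "filterlim (\<lambda>x. log m x) at_top at_top"
    unfolding log_def using mean_gt_1 by real_asymp
  have a_right: "filterlim a (at_right 0) sequentially"
    using a0 pos by (simp add: filterlim_at order_less_imp_not_eq2)
  have "filterlim (\<lambda>n. log m (inverse (a n))) at_top sequentially"
    by (intro filterlim_compose[OF lim_log] filterlim_compose[OF filterlim_inverse_at_top_right a_right])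
  hence nlog: "filterlim (\<lambda>n. - log m (a n)) at_top sequentially"
    using pos mean_gt_1 by (simp add: log_inverse)
  have j_ge: "- log m (a n) \<le> real (j n)" for n unfolding j_def by linarith
  have j1: "filterlim j at_top sequentially"
    by (rule filterlim_at_top_of_real, rule filterlim_at_top_mono[OF nlog]) (use j_ge in auto)
  from nlog have "\<forall>\<^sub>F n in sequentially. 0 \<le> - log m (a n)" unfolding filterlim_at_top by blast
  hence j_le: "\<forall>\<^sub>F n in sequentially. real (j n) \<le> - log m (a n) + 1"
    by eventually_elim (simp add: j_def, linarith)
  have log_an: "log m (a n * m ^ n) = log m (a n) + real n" for n
    using pos[of n] mean_gt_1 by (subst log_mult) (auto simp: log_nat_power)
  have "filterlim (\<lambda>n. -1 + log m (a n * m ^ n)) at_top sequentially"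
    by (intro filterlim_tendsto_add_at_top[OF tendsto_const] filterlim_compose[OF lim_log] ainf)
  moreover from j_le have "\<forall>\<^sub>F n in sequentially. -1 + log m (a n * m ^ n) \<le> real (n - j n)"
    by eventually_elim (simp add: log_an)
  ultimately have j2: "filterlim (\<lambda>n. n - j n) at_top sequentially"
    by (intro filterlim_at_top_of_real) (rule filterlim_at_top_mono)
  \<comment> \<open>Both comparison sequences use the same \<open>j\<close>. As \<open>a n\<close>
    lies between \<open>1 / m ^ j n\<close> and \<open>m / m ^ j n\<close>, \<open>x\<close> takes
    \<open>\<theta>\<close> and divides by \<open>\<mu>\<close> because the normalisation can be
    \<open>\<mu>\<close> times as large as \<open>\<mu> ^ (n - j n)\<close>; \<open>y\<close> takes
    \<open>m * \<theta>\<close>, and the functional equations turn this into the factor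
    \<open>\<mu>\<close>.\<close>
  define x where "x n = log_iterate (n - j n) ((f ^^ j n) (exp (- \<theta> / m ^ j n))) / real \<mu>" for n
  define y where "y n = log_iterate (n - j n) ((f ^^ j n) (exp (- (m * \<theta>) / m ^ j n)))" for n
  have mt: "m * \<theta> > 0" using \<theta> mean_gt_1 by simp
  have bounds: "\<forall>\<^sub>F n in sequentially. y n \<le> normalized_log_gf \<theta> a n \<and> normalized_log_gf \<theta> a n \<le> x n"
  proof -
    from j2 have "\<forall>\<^sub>F n in sequentially. 1 \<le> n - j n" by (simp add: filterlim_at_top)
    with j_le show ?thesis
    proof eventually_elim
      case (elim n)
      hence jn: "j n \<le> n" by simp
      have m0: "m > 0" using mean_gt_1 by simp
      have eq: "a n = m powr log m (a n)" using pos[of n] mean_gt_1 by simp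
      have "m powr (- real (j n)) \<le> a n"
        by (subst eq, rule powr_mono) (use j_ge[of n] mean_gt_1 in auto)
      hence lo: "1 / m ^ j n \<le> a n" using m0 by (simp add: powr_minus powr_realpow divide_inverse)
      have "a n \<le> m powr (1 - real (j n))"
        by (subst eq, rule powr_mono) (use elim mean_gt_1 in auto)
      hence hi: "a n \<le> m / m ^ j n" using m0 by (simp add: powr_diff powr_realpow)
      let ?r = "(a n * m ^ n) powr \<beta>" and ?u = "real \<mu> ^ (n - j n)"
      have u0: "?u > 0" using index_ge_2 by simp
      have "m ^ (n - j n) \<le> a n * m ^ n"
        using mult_right_mono[OF lo, of "m ^ n"] m0 jn by (simp add: power_diff)
      from powr_mono2[OF _ _ this, of \<beta>] have ur: "?u \<le> ?r"
        using boettcher_const_pos m0 by (simp add: power_mean_powr)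
      have "a n * m ^ n \<le> m ^ Suc (n - j n)"
        using mult_right_mono[OF hi, of "m ^ n"] m0 jn by (simp add: power_diff)
      from powr_mono2[OF _ _ this, of \<beta>] have ru: "?r \<le> real \<mu> * ?u"
        using boettcher_const_pos m0 pos[of n] unfolding power_mean_powr by simp
      let ?F = "\<lambda>t. ln ((f ^^ n) (exp (- t)))"
      have F_mono: "?F t \<le> ?F s" if "0 \<le> s" "s \<le> t" for s t
        using that iterate_in[OF exp_in(2), of t n] iterate_in[OF exp_in(2), of s n]
        by (subst ln_le_cancel_iff) (auto intro!: iterate_mono)
      have F_neg: "?F t \<le> 0" if "0 \<le> t" for t
        using that iterate_in[OF exp_in(2), of t n] by simp
      have t1: "\<theta> / m ^ j n \<le> \<theta> * a n" using mult_left_mono[OF lo, of \<theta>] \<theta> by simp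
      have t2: "\<theta> * a n \<le> m * \<theta> / m ^ j n" using mult_left_mono[OF hi, of \<theta>] \<theta> by (simp add: mult.commute)
      have t0: "0 \<le> \<theta> / m ^ j n" "0 \<le> \<theta> * a n" "0 \<le> m * \<theta> / m ^ j n"
        using \<theta> m0 pos[of n] by auto
      have r0: "?r > 0" using u0 ur by linarith
      have "y n = ?F (m * \<theta> / m ^ j n) / ?u" using jn by (simp add: y_def log_iterate_split)
      \<comment> \<open>The logarithms are nonpositive, so a larger denominator gives a larger
        quotient.\<close>
      also have "\<dots> \<le> ?F (m * \<theta> / m ^ j n) / ?r"
        using F_neg[OF t0(3)] ur u0 r0 by (intro divide_left_mono_neg) auto
      also have "\<dots> \<le> ?F (\<theta> * a n) / ?r"
        by (rule divide_right_mono[OF F_mono[OF t0(2) t2]]) simp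
      finally have 1: "y n \<le> normalized_log_gf \<theta> a n" by (simp add: normalized_log_gf_def)
      have "normalized_log_gf \<theta> a n = ?F (\<theta> * a n) / ?r" by (simp add: normalized_log_gf_def)
      also have "\<dots> \<le> ?F (\<theta> / m ^ j n) / ?r"
        by (rule divide_right_mono[OF F_mono[OF t0(1) t1]]) simp
      also have "\<dots> \<le> ?F (\<theta> / m ^ j n) / (real \<mu> * ?u)"
        using F_neg[OF t0(1)] ru r0 u0 index_ge_2 by (intro divide_left_mono_neg mult_pos_pos) auto
      also have "\<dots> = x n" using jn by (simp add: x_def log_iterate_split)
      finally show ?case using 1 by simp
    qed
  qed
  show thesis
  proof (rule that)
    show "y \<longlonglongrightarrow> real \<mu> * ln (boettcher_B p (\<Phi> \<theta>))"
      using log_iterate_split_limit[OF mt j1 j2] laplace_scale[OF \<theta>] ln_boettcher_gf[OF laplace_in[OF \<theta>]]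
      by (simp add: y_def[abs_def])
    show "x \<longlonglongrightarrow> ln (boettcher_B p (\<Phi> \<theta>)) / real \<mu>"
      unfolding x_def[abs_def] using index_ge_2
      by (intro tendsto_divide log_iterate_split_limit[OF \<theta> j1 j2] tendsto_const) simp
  qed (use bounds in \<open>auto elim: eventually_mono\<close>)
qed

end

section \<open>Convergence of nonnegative martingales\<close>

text \<open>The state of the buy-low, sell-high strategy: one unit is bought when the value is below
  \<open>a\<close> and kept until the value exceeds \<open>b\<close>. The sales are counted by
  \<open>upcrossings\<close>.\<close>

primrec holding :: "real \<Rightarrow> real \<Rightarrow> (nat \<Rightarrow> real) \<Rightarrow> nat \<Rightarrow> bool" where
  "holding a b y 0 \<longleftrightarrow> y 0 < a"
| "holding a b y (Suc n) \<longleftrightarrow> (if holding a b y n then y (Suc n) \<le> b else y (Suc n) < a)"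

primrec upcrossings :: "real \<Rightarrow> real \<Rightarrow> (nat \<Rightarrow> real) \<Rightarrow> nat \<Rightarrow> nat" where
  "upcrossings a b y 0 = 0"
| "upcrossings a b y (Suc n) = upcrossings a b y n + (if holding a b y n \<and> b < y (Suc n) then 1 else 0)"

text \<open>Doob's upcrossing inequality, path by path: the right side is the gain of the strategy.
  Each sale brings at least \<open>b - a\<close>, and an open position was bought below
  \<open>a\<close>, so it has gained at least \<open>y n - a\<close>; recording this open term makes
  the induction close.\<close>

lemma upcrossings_gain:
  assumes "a < b"
  shows "(b - a) * real (upcrossings a b y n) + (if holding a b y n then y n - a else 0)
    \<le> (\<Sum>k<n. if holding a b y k then y (Suc k) - y k else 0)"
proof (induction n)
  case (Suc n)
  thus ?case using assms by (auto simp: algebra_simps split: if_splits)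
qed auto

lemma upcrossings_unbounded:
  assumes ab: "a < b" and lo: "\<exists>\<^sub>F n in sequentially. y n < a" and hi: "\<exists>\<^sub>F n in sequentially. b < y n"
  shows "\<exists>n. N \<le> upcrossings a b y n"
proof (induction N)
  case (Suc N)
  then obtain n where n: "N \<le> upcrossings a b y n" by blast
  have mono: "upcrossings a b y i \<le> upcrossings a b y j" if "i \<le> j" for i j
    using that by (induction rule: dec_induct) auto
  have up: "\<exists>l\<ge>i. holding a b y l \<and> b < y (Suc l)" if h: "holding a b y i" for i
  proof (rule ccontr)
    assume c: "\<not> (\<exists>l\<ge>i. holding a b y l \<and> b < y (Suc l))"
    have "holding a b y l" if "i \<le> l" for l
      using that
    proof (induction rule: dec_induct)
      case (step l) thus ?case using c by (auto simp: not_less)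
    qed (rule h)
    moreover obtain l where "Suc i \<le> l" "b < y l" using hi
      unfolding frequently_sequentially by blast
    ultimately show False using c by (cases l) auto
  qed
  obtain i where i: "n \<le> i" "holding a b y i"
  proof -
    obtain k where k: "Suc n \<le> k" "y k < a" using lo unfolding frequently_sequentially by blast
    then obtain k' where k': "k = Suc k'" by (cases k) auto
    \<comment> \<open>Whatever the previous state, a value below \<open>a\<close> leaves the
      strategy holding: an idle one buys, and one already holding does not sell because
      \<open>a < b\<close>.\<close>
    have "holding a b y k" using k ab k' by auto
    thus ?thesis using that[of k] k by simp
  qed
  from up[OF i(2)] obtain l where l: "i \<le> l" "holding a b y l" "b < y (Suc l)" by blast
  have "Suc N \<le> upcrossings a b y (Suc l)" using l n mono[of n l] i(1) by simp
  thus ?case by blast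
qed auto

lemma holding_measurable:
  assumes "\<And>k. k \<le> n \<Longrightarrow> Y k \<in> borel_measurable F"
  shows "Measurable.pred F (\<lambda>\<omega>. holding a b (\<lambda>k. Y k \<omega>) n)"
  using assms
proof (induction n)
  case 0
  hence [measurable]: "Y 0 \<in> borel_measurable F" by simp
  show ?case by simp
next
  case (Suc n)
  hence [measurable]: "Y (Suc n) \<in> borel_measurable F" "Measurable.pred F (\<lambda>\<omega>. holding a b (\<lambda>k. Y k \<omega>) n)" by simp_all
  show ?case by simp
qed

lemma upcrossings_measurable:
  assumes [measurable]: "\<And>k. Y k \<in> borel_measurable F"
  shows "(\<lambda>\<omega>. upcrossings a b (\<lambda>k. Y k \<omega>) n) \<in> measurable F (count_space UNIV)"
proof (induction n)
  case (Suc n)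
  note [measurable] = Suc holding_measurable[of n Y F a b, OF assms]
  show ?case by simp
qed simp

text \<open>If the liminf were below the limsup, two rational levels between them would each be
  passed infinitely often. Rational levels keep the exceptional sets of the almost sure version
  countable in number.\<close>

lemma nonneg_convergent_if_no_oscillation:
  fixes y :: "nat \<Rightarrow> real"
  assumes nn: "\<And>n. 0 \<le> y n" and fin: "liminf (\<lambda>n. ereal (y n)) < \<infinity>"
    and osc: "\<And>a b. a \<in> \<rat> \<Longrightarrow> b \<in> \<rat> \<Longrightarrow> a < b \<Longrightarrow>
      \<not> ((\<exists>\<^sub>F n in sequentially. y n < a) \<and> (\<exists>\<^sub>F n in sequentially. b < y n))"
  shows "y \<longlonglongrightarrow> real_of_ereal (limsup (\<lambda>n. ereal (y n)))"
proof -
  let ?l = "liminf (\<lambda>n. ereal (y n))" and ?u = "limsup (\<lambda>n. ereal (y n))"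
  have le: "?l \<le> ?u" by (simp add: Liminf_le_Limsup)
  have "\<not> ?l < ?u"
  proof
    assume "?l < ?u"
    then obtain a where a: "?l < ereal a" "ereal a < ?u" using ereal_dense2 by blast
    then obtain b where b: "ereal a < ereal b" "ereal b < ?u" using ereal_dense2 by blast
    obtain q where q: "q \<in> \<rat>" "a < q" "q < b" using Rats_dense_in_real[of a b] b by auto
    obtain r where r: "r \<in> \<rat>" "q < r" "r < b" using Rats_dense_in_real[of q b] q by auto
    note qr = q(1) r(1) q(2) r(2,3)
    have "?l < ereal q" by (rule less_trans[OF a(1)]) (use qr in simp)
    have "ereal r < ?u" by (rule less_trans[OF _ b(2)]) (use qr in simp)
    have "\<exists>\<^sub>F n in sequentially. y n < q"
    proof (rule ccontr)
      assume "\<not> (\<exists>\<^sub>F n in sequentially. y n < q)"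
      hence "\<forall>\<^sub>F n in sequentially. ereal q \<le> ereal (y n)" by (simp add: not_frequently not_less)
      hence "ereal q \<le> ?l" by (rule Liminf_bounded)
      thus False using \<open>?l < ereal q\<close> by simp
    qed
    moreover have "\<exists>\<^sub>F n in sequentially. r < y n"
    proof (rule ccontr)
      assume "\<not> (\<exists>\<^sub>F n in sequentially. r < y n)"
      hence "\<forall>\<^sub>F n in sequentially. ereal (y n) \<le> ereal r" by (simp add: not_frequently not_less)
      hence "?u \<le> ereal r" by (rule Limsup_bounded)
      thus False using \<open>ereal r < ?u\<close> by simp
    qed
    ultimately show False using osc[OF qr(1,2,4)] by blast
  qed
  hence eq: "?l = ?u" using le by simp
  have "0 \<le> ?l" using nn by (intro Liminf_bounded) auto
  hence "\<bar>?u\<bar> \<noteq> \<infinity>" using fin eq by auto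
  hence "?u = ereal (real_of_ereal ?u)" by (simp add: ereal_real)
  moreover have "(\<lambda>n. ereal (y n)) \<longlonglongrightarrow> ?u" using eq by (intro Liminf_eq_Limsup) auto
  ultimately show ?thesis by (metis lim_ereal)
qed

text \<open>The strategy has expected gain zero, so the mean number of upcrossings is at most
  \<open>\<bar>a\<bar> / (b - a)\<close>, whatever the number of steps. \<open>adapted\<close>
  covers the whole history because \<open>holding\<close> at time \<open>n\<close> depends on all
  earlier values.\<close>

theorem (in prob_space) nonneg_martingale_convergence:
  fixes Y :: "nat \<Rightarrow> 'a \<Rightarrow> real"
  assumes sub: "\<And>n. space (F n) = space M" "\<And>n. sets (F n) \<subseteq> sets M"
    and adapted: "\<And>n k. k \<le> n \<Longrightarrow> Y k \<in> borel_measurable (F n)"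
    and nn: "\<And>n \<omega>. 0 \<le> Y n \<omega>" and int: "\<And>n. integrable M (Y n)"
    and mart: "\<And>n A. A \<in> sets (F n) \<Longrightarrow>
      (\<integral>\<omega>. indicator A \<omega> * Y (Suc n) \<omega> \<partial>M) = (\<integral>\<omega>. indicator A \<omega> * Y n \<omega> \<partial>M)"
  shows "AE \<omega> in M. (\<lambda>n. Y n \<omega>) \<longlonglongrightarrow> real_of_ereal (limsup (\<lambda>n. ereal (Y n \<omega>)))"
proof -
  have meas[measurable]: "Y n \<in> borel_measurable M" for n using int by auto
  note [measurable] = upcrossings_measurable[OF meas]

  have exp_le: "expectation (\<lambda>\<omega>. real (upcrossings a b (\<lambda>k. Y k \<omega>) n)) \<le> \<bar>a\<bar> / (b - a)"
    and int_up: "integrable M (\<lambda>\<omega>. real (upcrossings a b (\<lambda>k. Y k \<omega>) n))"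
    if ab: "a < b" for a b n
  proof -
    let ?H = "\<lambda>k. {\<omega> \<in> space M. holding a b (\<lambda>k. Y k \<omega>) k}"
    have H: "?H k \<in> sets (F k)" for k
      using holding_measurable[of k Y "F k" a b] adapted sub(1)[of k] by (auto simp: pred_def)
    have HM[measurable]: "?H k \<in> sets M" for k using H sub(2) by blast
    have up_le: "upcrossings a b y n \<le> n" for y by (induction n) auto
    show int_up: "integrable M (\<lambda>\<omega>. real (upcrossings a b (\<lambda>k. Y k \<omega>) n))"
      by (rule integrable_const_bound[where B=n]) (auto simp: up_le)
    have iI: "integrable M (\<lambda>\<omega>. indicator (?H k) \<omega> * Y j \<omega>)" for k j
      using integrable_mult_indicator[OF HM int, of k j] by simp
    let ?G = "\<lambda>\<omega>. \<Sum>k<n. indicator (?H k) \<omega> * Y (Suc k) \<omega> - indicator (?H k) \<omega> * Y k \<omega>"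
    \<comment> \<open>Summand \<open>k\<close> is the increment of \<open>Y\<close> on
      \<open>?H k\<close>, an event of \<open>F k\<close>, so \<open>mart\<close> makes its mean
      zero.\<close>
    have "expectation ?G = 0"
      using iI mart[OF H] by (subst Bochner_Integration.integral_sum) (auto simp: Bochner_Integration.integral_diff)
    \<comment> \<open>Here nonnegativity of \<open>Y\<close> enters: an open position contributes at
      least \<open>- a\<close>, hence at least \<open>- \<bar>a\<bar>\<close>.\<close>
    moreover have "expectation (\<lambda>\<omega>. (b - a) * real (upcrossings a b (\<lambda>k. Y k \<omega>) n) - \<bar>a\<bar>) \<le> expectation ?G"
    proof (intro integral_mono)
      fix \<omega> assume w: "\<omega> \<in> space M"
      have "?G \<omega> = (\<Sum>k<n. if holding a b (\<lambda>k. Y k \<omega>) k then Y (Suc k) \<omega> - Y k \<omega> else 0)"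
        using w by (intro sum.cong) (auto simp: indicator_def)
      with upcrossings_gain[OF ab, of "\<lambda>k. Y k \<omega>" n] nn[of n \<omega>]
      show "(b - a) * real (upcrossings a b (\<lambda>k. Y k \<omega>) n) - \<bar>a\<bar> \<le> ?G \<omega>"
        by (auto split: if_splits)
    qed (use iI int_up in auto)
    moreover have "expectation (\<lambda>\<omega>. (b - a) * real (upcrossings a b (\<lambda>k. Y k \<omega>) n) - \<bar>a\<bar>)
       = (b - a) * expectation (\<lambda>\<omega>. real (upcrossings a b (\<lambda>k. Y k \<omega>) n)) - \<bar>a\<bar>"
      using int_up by (simp add: prob_space)
    ultimately show "expectation (\<lambda>\<omega>. real (upcrossings a b (\<lambda>k. Y k \<omega>) n)) \<le> \<bar>a\<bar> / (b - a)"
      using ab by (simp add: field_simps)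
  qed

  have bdd: "AE \<omega> in M. \<exists>N. \<forall>n. upcrossings a b (\<lambda>k. Y k \<omega>) n < N" if ab: "a < b" for a b
  proof -
    let ?U = "\<lambda>n \<omega>. ennreal (real (upcrossings a b (\<lambda>k. Y k \<omega>) n))"
    have "(\<integral>\<^sup>+\<omega>. (SUP n. ?U n \<omega>) \<partial>M) = (SUP n. \<integral>\<^sup>+\<omega>. ?U n \<omega> \<partial>M)"
      by (rule nn_integral_monotone_convergence_SUP) (auto simp: incseq_Suc_iff le_fun_def)
    also have "\<dots> \<le> ennreal (\<bar>a\<bar> / (b - a))"
      using exp_le[OF ab] int_up[OF ab]
      by (intro SUP_least) (auto simp: nn_integral_eq_integral intro!: ennreal_leI)
    finally have "(\<integral>\<^sup>+\<omega>. (SUP n. ?U n \<omega>) \<partial>M) \<noteq> \<infinity>" by (auto simp: top_unique)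
    hence "AE \<omega> in M. (SUP n. ?U n \<omega>) \<noteq> \<infinity>" by (intro nn_integral_noteq_infinite) auto
    thus ?thesis
    proof eventually_elim
      case (elim \<omega>)
      then obtain r where r: "(SUP n. ?U n \<omega>) = ennreal r" "r \<ge> 0" by (cases "SUP n. ?U n \<omega>") auto
      have "real (upcrossings a b (\<lambda>k. Y k \<omega>) n) \<le> r" for n
        using SUP_upper[of n UNIV "\<lambda>n. ?U n \<omega>"] r by simp
      moreover obtain N :: nat where "r < real N" using reals_Archimedean2 by blast
      ultimately have "real (upcrossings a b (\<lambda>k. Y k \<omega>) n) < real N" for n by (rule le_less_trans)
      thus ?case by auto
    qed
  qed

  have mean: "expectation (Y n) = expectation (Y 0)" for n
  proof (induction n)
    case (Suc n)
    have "expectation (Y k) = (\<integral>\<omega>. indicator (space M) \<omega> * Y k \<omega> \<partial>M)" for k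
      by (intro Bochner_Integration.integral_cong) auto
    thus ?case using mart[of "space M" n] sub(1)[of n] Suc sets.top[of "F n"] by simp
  qed simp
  \<comment> \<open>Fatou's lemma with constant means: the liminf has finite integral, hence is
    finite almost surely, which rules out divergence to infinity.\<close>
  have "(\<integral>\<^sup>+\<omega>. liminf (\<lambda>n. ennreal (Y n \<omega>)) \<partial>M) \<le> liminf (\<lambda>n. \<integral>\<^sup>+\<omega>. ennreal (Y n \<omega>) \<partial>M)"
    by (rule nn_integral_liminf) auto
  also have "\<dots> = ennreal (expectation (Y 0))"
  proof -
    have "(\<integral>\<^sup>+\<omega>. ennreal (Y n \<omega>) \<partial>M) = ennreal (expectation (Y 0))" for n
      unfolding mean[of n, symmetric] using int nn by (intro nn_integral_eq_integral) auto
    thus ?thesis by (simp add: Liminf_const)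
  qed
  finally have "(\<integral>\<^sup>+\<omega>. liminf (\<lambda>n. ennreal (Y n \<omega>)) \<partial>M) \<noteq> \<infinity>" by (auto simp: top_unique)
  hence fin: "AE \<omega> in M. liminf (\<lambda>n. ennreal (Y n \<omega>)) \<noteq> \<infinity>" by (intro nn_integral_noteq_infinite) auto

  have "AE \<omega> in M. \<forall>a\<in>\<rat>. \<forall>b\<in>\<rat>. a < b \<longrightarrow> (\<exists>N. \<forall>n. upcrossings a b (\<lambda>k. Y k \<omega>) n < N)"
    using bdd by (simp add: AE_ball_countable countable_rat)
  with fin show ?thesis
  proof eventually_elim
    case (elim \<omega>)
    show ?case
    proof (rule nonneg_convergent_if_no_oscillation[OF nn])
      \<comment> \<open>Finiteness is carried from \<open>ennreal\<close> to \<open>ereal\<close>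
        through a real level \<open>r\<close> below which \<open>Y\<close> falls infinitely
        often.\<close>
      obtain r where r: "liminf (\<lambda>n. ennreal (Y n \<omega>)) < ennreal r" "r \<ge> 0"
      proof -
        obtain x where x: "liminf (\<lambda>n. ennreal (Y n \<omega>)) = ennreal x" "0 \<le> x"
          using elim(1) by (cases "liminf (\<lambda>n. ennreal (Y n \<omega>))") auto
        show ?thesis by (rule that[of "x + 1"]) (use x in \<open>auto simp: ennreal_less_iff simp del: ennreal_plus\<close>)
      qed
      have "\<exists>\<^sub>F n in sequentially. Y n \<omega> < r"
      proof (rule ccontr)
        assume "\<not> (\<exists>\<^sub>F n in sequentially. Y n \<omega> < r)"
        hence "\<forall>\<^sub>F n in sequentially. r \<le> Y n \<omega>" by (simp add: not_frequently not_less)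
        hence "\<forall>\<^sub>F n in sequentially. ennreal r \<le> ennreal (Y n \<omega>)" by eventually_elim (auto intro: ennreal_leI)
        hence "ennreal r \<le> liminf (\<lambda>n. ennreal (Y n \<omega>))" by (rule Liminf_bounded)
        thus False using r by simp
      qed
      hence "\<not> (\<forall>\<^sub>F n in sequentially. ereal (r + 1) < ereal (Y n \<omega>))"
      proof (rule contrapos_pn)
        assume "\<forall>\<^sub>F n in sequentially. ereal (r + 1) < ereal (Y n \<omega>)"
        hence "\<forall>\<^sub>F n in sequentially. \<not> Y n \<omega> < r" by eventually_elim auto
        thus "\<not> (\<exists>\<^sub>F n in sequentially. Y n \<omega> < r)" by (simp add: frequently_def)
      qed
      hence "\<not> ereal (r + 1) < liminf (\<lambda>n. ereal (Y n \<omega>))" using less_LiminfD by blast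
      thus "liminf (\<lambda>n. ereal (Y n \<omega>)) < \<infinity>" by (auto simp: not_less intro: le_less_trans)
    next
      fix a b :: real assume "a \<in> \<rat>" "b \<in> \<rat>" "a < b"
      with elim(2) obtain N where N: "upcrossings a b (\<lambda>k. Y k \<omega>) n < N" for n by blast
      show "\<not> ((\<exists>\<^sub>F n in sequentially. Y n \<omega> < a) \<and> (\<exists>\<^sub>F n in sequentially. b < Y n \<omega>))"
      proof
        assume "(\<exists>\<^sub>F n in sequentially. Y n \<omega> < a) \<and> (\<exists>\<^sub>F n in sequentially. b < Y n \<omega>)"
        with upcrossings_unbounded[OF \<open>a < b\<close>, of "\<lambda>k. Y k \<omega>" N] N show False
          by (auto simp: not_le[symmetric])
      qed
    qed
  qed
qed

section \<open>The Galton-Watson process\<close>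

lemma (in prob_space) indep_var_nn_integral:
  fixes u v :: "'a \<Rightarrow> ennreal"
  assumes "indep_var borel u borel v"
  shows "(\<integral>\<^sup>+\<omega>. u \<omega> * v \<omega> \<partial>M) = (\<integral>\<^sup>+\<omega>. u \<omega> \<partial>M) * (\<integral>\<^sup>+\<omega>. v \<omega> \<partial>M)"
proof -
  have "case_bool borel borel = (\<lambda>_. borel :: ennreal measure)" by (auto simp: fun_eq_iff split: bool.split)
  hence "indep_vars (\<lambda>_. borel) (case_bool u v) UNIV" using assms by (simp add: indep_var_def)
  from indep_vars_nn_integral[OF _ this] show ?thesis by (simp add: UNIV_bool mult.commute)
qed

locale GW_walk = prob_space M for M :: "'a measure" +
  fixes p :: "nat pmf" and xi :: "nat \<Rightarrow> nat \<Rightarrow> 'a \<Rightarrow> nat" and X :: "nat \<Rightarrow> 'a \<Rightarrow> real"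
  assumes xi_measurable[measurable]: "\<And>n i. xi n i \<in> measurable M (count_space UNIV)"
    and xi_distr: "\<And>n i. distr M (count_space UNIV) (xi n i) = measure_pmf p"
    and X_measurable[measurable]: "\<And>j. X j \<in> borel_measurable M"
    and X_distr: "\<And>j. distr M borel (X j) = distr M borel (X 0)"
    and indep: "indep_vars (\<lambda>_. borel)
           (\<lambda>(i :: (nat \<times> nat) + nat) \<omega>. case i of Inl (n, k) \<Rightarrow> real (xi n k \<omega>) | Inr j \<Rightarrow> X j \<omega>) UNIV"
begin

section \<open>Algebras generated by blocks of coordinates, and conditioning on the past\<close>

definition coord :: "(nat \<times> nat) + nat \<Rightarrow> 'a \<Rightarrow> real" where
  "coord i \<omega> = (case i of Inl (n, k) \<Rightarrow> real (xi n k \<omega>) | Inr j \<Rightarrow> X j \<omega>)"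

text \<open>The sigma-algebra generated by the coordinates in \<open>I\<close>, encoded as the
  preimage algebra of the restricted coordinate map because \<open>indep_var_restrict\<close> speaks
  about exactly these maps.\<close>

definition alg :: "((nat \<times> nat) + nat) set \<Rightarrow> 'a measure" where
  "alg I = vimage_algebra (space M) (\<lambda>\<omega>. restrict (\<lambda>i. coord i \<omega>) I) (PiM I (\<lambda>_. borel))"

abbreviation "Z \<equiv> GW_pop xi"

text \<open>The offspring counts that determine \<open>Z 0\<close> up to \<open>Z n\<close>:
  generation \<open>n\<close> itself has not yet reproduced.\<close>

definition past :: "nat \<Rightarrow> ((nat \<times> nat) + nat) set" where
  "past n = {Inl (k, i) | k i. k < n}"

lemma space_alg[simp]: "space (alg I) = space M" by (simp add: alg_def)

lemma indep_coord: "indep_vars (\<lambda>_. borel) coord UNIV"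
  using indep by (simp add: coord_def[abs_def])

lemma restrict_coord_measurable: "(\<lambda>\<omega>. restrict (\<lambda>i. coord i \<omega>) I) \<in> measurable M (PiM I (\<lambda>_. borel))"
  using indep_coord by (intro measurable_restrict) (simp add: indep_vars_def)

lemma sets_alg: "sets (alg I) = {(\<lambda>\<omega>. restrict (\<lambda>i. coord i \<omega>) I) -` A \<inter> space M | A. A \<in> sets (PiM I (\<lambda>_. borel))}"
  unfolding alg_def by (rule sets_vimage_algebra2) (auto simp: space_PiM)

lemma sets_alg_subset: "sets (alg I) \<subseteq> sets M"
  unfolding sets_alg using restrict_coord_measurable by (auto intro: measurable_sets)

lemma measurable_from_alg: "u \<in> measurable (alg I) N \<Longrightarrow> u \<in> measurable M N"
  by (rule measurable_from_subalg) (use sets_alg_subset in \<open>auto simp: subalgebra_def\<close>)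

lemma coord_alg: "i \<in> I \<Longrightarrow> coord i \<in> borel_measurable (alg I)"
proof -
  assume i: "i \<in> I"
  have "(\<lambda>\<omega>. restrict (\<lambda>i. coord i \<omega>) I) \<in> measurable (alg I) (PiM I (\<lambda>_. borel))"
    unfolding alg_def by (rule measurable_vimage_algebra1) (auto simp: space_PiM)
  from measurable_compose[OF this measurable_component_singleton[OF i]] show ?thesis using i by simp
qed

lemma xi_alg: assumes "Inl (n, k) \<in> I" shows "xi n k \<in> measurable (alg I) (count_space UNIV)"
proof -
  have [measurable]: "coord (Inl (n, k)) \<in> borel_measurable (alg I)" by (rule coord_alg[OF assms])
  \<comment> \<open>The coordinates are real-valued; the floor recovers the natural number
    measurably.\<close>
  have "(\<lambda>\<omega>. nat \<lfloor>coord (Inl (n, k)) \<omega>\<rfloor>) \<in> measurable (alg I) (count_space UNIV)" by measurable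
  thus ?thesis by (simp add: coord_def)
qed

lemma X_alg: assumes "Inr j \<in> I" shows "X j \<in> borel_measurable (alg I)"
  using coord_alg[OF assms] by (simp add: coord_def[abs_def])

text \<open>Independence of two disjoint coordinate blocks is independence of the algebras they
  generate. Read as independence of two identity maps, it passes to all measurable functions by
  composition.\<close>

lemma indep_alg:
  assumes "I \<inter> J = {}" "u \<in> measurable (alg I) N1" "v \<in> measurable (alg J) N2"
  shows "indep_var N1 u N2 v"
proof -
  have "indep_var (PiM I (\<lambda>_. borel)) (\<lambda>\<omega>. restrict (\<lambda>i. coord i \<omega>) I)
    (PiM J (\<lambda>_. borel)) (\<lambda>\<omega>. restrict (\<lambda>i. coord i \<omega>) J)"
    by (rule indep_var_restrict[OF indep_coord]) (use assms in auto)
  hence "indep_set (sigma_sets (space M) (sets (alg I))) (sigma_sets (space M) (sets (alg J)))"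
    unfolding indep_var_eq sets_alg by blast
  moreover have "{(\<lambda>\<omega>. \<omega>) -` A \<inter> space M | A. A \<in> sets (alg I)} = sets (alg I)" for I
    using sets.sets_into_space[of _ "alg I"] by (auto simp: Int_absorb2)
  ultimately have "indep_var (alg I) (\<lambda>\<omega>. \<omega>) (alg J) (\<lambda>\<omega>. \<omega>)"
    unfolding indep_var_eq using measurable_from_alg[OF measurable_ident_sets[OF refl]] by auto
  from indep_var_compose[OF this assms(2,3)] show ?thesis by (simp add: o_def)
qed

lemma GW_pop_alg: "k \<le> n \<Longrightarrow> Z k \<in> measurable (alg (past n)) (count_space UNIV)"
proof (induction k)
  case (Suc k)
  have [measurable]: "xi k i \<in> measurable (alg (past n)) (count_space UNIV)" for i
    using Suc by (intro xi_alg) (auto simp: past_def)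
  have "(\<lambda>\<omega>. \<Sum>i<Z k \<omega>. xi k i \<omega>) \<in> measurable (alg (past n)) (count_space UNIV)"
    by (rule measurable_compose_countable[OF _ Suc.IH]) (use Suc in auto)
  thus ?case by simp
next
  case 0
  have "Z 0 = (\<lambda>_. 1)" by (simp add: fun_eq_iff)
  thus ?case by simp
qed

lemma GW_pop_measurable[measurable]: "Z k \<in> measurable M (count_space UNIV)"
  using measurable_from_alg[OF GW_pop_alg[of k k]] by simp

text \<open>The substitute for conditioning on \<open>Z n\<close>: on the event
  \<open>Z n = j\<close> the integrand is \<open>g j\<close>, which is independent of the past, so
  it may be averaged with the index frozen. The block \<open>J\<close> will be either the next
  generation or the walk.\<close>

lemma nn_integral_random_index:
  fixes g :: "nat \<Rightarrow> 'a \<Rightarrow> ennreal"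
  assumes S: "S \<in> sets (alg (past n))" and J: "past n \<inter> J = {}"
    and g: "\<And>j. g j \<in> borel_measurable (alg J)"
  shows "(\<integral>\<^sup>+\<omega>. indicator S \<omega> * g (Z n \<omega>) \<omega> \<partial>M) = (\<integral>\<^sup>+\<omega>. indicator S \<omega> * (\<integral>\<^sup>+\<omega>'. g (Z n \<omega>) \<omega>' \<partial>M) \<partial>M)"
proof -
  let ?S = "\<lambda>j. S \<inter> (Z n -` {j} \<inter> space M)"
  have Sj: "?S j \<in> sets (alg (past n))" for j
    using S measurable_sets[OF GW_pop_alg[of n n], of "{j}"] by simp
  have SjM[measurable]: "?S j \<in> sets M" for j using Sj sets_alg_subset by blast
  have [measurable]: "g j \<in> borel_measurable M" for j using measurable_from_alg[OF g] .
  have split: "(\<Sum>j. indicator (?S j) \<omega> * h j) = indicator S \<omega> * h (Z n \<omega>)"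
    if "\<omega> \<in> space M" for \<omega> and h :: "nat \<Rightarrow> ennreal"
    using that by (subst suminf_finite[of "{Z n \<omega>}"]) (auto simp: indicator_def)
  have "(\<integral>\<^sup>+\<omega>. indicator S \<omega> * g (Z n \<omega>) \<omega> \<partial>M) = (\<integral>\<^sup>+\<omega>. (\<Sum>j. indicator (?S j) \<omega> * g j \<omega>) \<partial>M)"
    by (intro nn_integral_cong) (simp add: split)
  also have "\<dots> = (\<Sum>j. \<integral>\<^sup>+\<omega>. indicator (?S j) \<omega> * g j \<omega> \<partial>M)"
    by (rule nn_integral_suminf) measurable
  also have "\<dots> = (\<Sum>j. \<integral>\<^sup>+\<omega>. indicator (?S j) \<omega> * (\<integral>\<^sup>+\<omega>'. g j \<omega>' \<partial>M) \<partial>M)"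
  proof (intro suminf_cong)
    fix j
    have "indep_var borel (indicator (?S j)) borel (g j)"
      by (rule indep_alg[OF J _ g]) (use Sj in simp)
    from indep_var_nn_integral[OF this]
    show "(\<integral>\<^sup>+\<omega>. indicator (?S j) \<omega> * g j \<omega> \<partial>M) = (\<integral>\<^sup>+\<omega>. indicator (?S j) \<omega> * (\<integral>\<^sup>+\<omega>'. g j \<omega>' \<partial>M) \<partial>M)"
      by (subst nn_integral_multc) auto
  qed
  also have "\<dots> = (\<integral>\<^sup>+\<omega>. (\<Sum>j. indicator (?S j) \<omega> * (\<integral>\<^sup>+\<omega>'. g j \<omega>' \<partial>M)) \<partial>M)"
    by (rule nn_integral_suminf[symmetric]) measurable
  also have "\<dots> = (\<integral>\<^sup>+\<omega>. indicator S \<omega> * (\<integral>\<^sup>+\<omega>'. g (Z n \<omega>) \<omega>' \<partial>M) \<partial>M)"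
    by (intro nn_integral_cong) (simp add: split)
  finally show ?thesis .
qed

lemma nn_integral_xi: "(\<integral>\<^sup>+\<omega>. h (xi n i \<omega>) \<partial>M) = (\<integral>\<^sup>+k. h k \<partial>measure_pmf p)"
  by (subst xi_distr[symmetric, of n i], subst nn_integral_distr) auto

section \<open>Generating functions, means and the limit of the generation sizes\<close>

definition generation :: "nat \<Rightarrow> ((nat \<times> nat) + nat) set" where
  "generation n = {Inl (n, i) | i. True}"

lemma past_generation: "past n \<inter> generation n = {}" and past_X: "past n \<inter> range Inr = {}"
  by (auto simp: past_def generation_def)

lemma sum_xi_alg: "(\<lambda>\<omega>. \<Sum>i<j. xi n i \<omega>) \<in> measurable (alg (generation n)) (count_space UNIV)"
proof -
  have [measurable]: "xi n i \<in> measurable (alg (generation n)) (count_space UNIV)" for i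
    by (intro xi_alg) (auto simp: generation_def)
  show ?thesis by measurable
qed

lemma nn_integral_power_sum_xi:
  assumes s: "0 \<le> s" "s \<le> 1"
  shows "(\<integral>\<^sup>+\<omega>. ennreal (s ^ (\<Sum>i<j. xi n i \<omega>)) \<partial>M) = ennreal (offspring_gf p s ^ j)"
proof (induction j)
  case (Suc j)
  let ?I = "{Inl (n, i) | i. i < j}" and ?J = "{Inl (n, j)}"
  have [measurable]: "xi n i \<in> measurable (alg ?I) (count_space UNIV)" if "i \<in> {..<j}" for i
    using that by (intro xi_alg) auto
  have [measurable]: "xi n j \<in> measurable (alg ?J) (count_space UNIV)" by (intro xi_alg) auto
  have u: "(\<lambda>\<omega>. ennreal (s ^ (\<Sum>i<j. xi n i \<omega>))) \<in> borel_measurable (alg ?I)"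
    by (rule measurable_compose[of "\<lambda>\<omega>. \<Sum>i<j. xi n i \<omega>" _ "count_space UNIV"]) auto
  have v: "(\<lambda>\<omega>. ennreal (s ^ xi n j \<omega>)) \<in> borel_measurable (alg ?J)"
    by (rule measurable_compose[of "xi n j" _ "count_space UNIV"]) auto
  have "(\<integral>\<^sup>+\<omega>. ennreal (s ^ (\<Sum>i<Suc j. xi n i \<omega>)) \<partial>M) =
    (\<integral>\<^sup>+\<omega>. ennreal (s ^ (\<Sum>i<j. xi n i \<omega>)) * ennreal (s ^ xi n j \<omega>) \<partial>M)"
    using s by (intro nn_integral_cong) (simp add: power_add ennreal_mult)
  also have "\<dots> = (\<integral>\<^sup>+\<omega>. ennreal (s ^ (\<Sum>i<j. xi n i \<omega>)) \<partial>M) * (\<integral>\<^sup>+\<omega>. ennreal (s ^ xi n j \<omega>) \<partial>M)"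
    by (rule indep_var_nn_integral, rule indep_alg[OF _ u v]) auto
  also have "(\<integral>\<^sup>+\<omega>. ennreal (s ^ xi n j \<omega>) \<partial>M) = ennreal (offspring_gf p s)"
    unfolding nn_integral_xi[of "\<lambda>k. ennreal (s ^ k)"] offspring_gf_def using s
    by (intro nn_integral_eq_integral measure_pmf.integrable_const_bound[where B=1]) (auto simp: power_le_one)
  finally show ?case using Suc s
    by (simp add: ennreal_mult[symmetric] offspring_gf_def mult.commute)
qed (simp add: emeasure_space_1)

lemma gf_bounds: assumes "0 \<le> s" "s \<le> 1" shows "0 \<le> offspring_gf p s" "offspring_gf p s \<le> 1"
proof -
  show "0 \<le> offspring_gf p s" using assms by (simp add: offspring_gf_def)
  have "offspring_gf p s \<le> measure_pmf.expectation p (\<lambda>_. 1)" unfolding offspring_gf_def using assms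
    by (intro integral_mono measure_pmf.integrable_const_bound[where B=1]) (auto simp: power_le_one)
  thus "offspring_gf p s \<le> 1" by simp
qed

text \<open>Averaging over the last generation first replaces \<open>s\<close> by the generating
  function at \<open>s\<close>; therefore the induction runs with \<open>s\<close>
  arbitrary.\<close>

lemma nn_integral_power_GW_pop:
  "0 \<le> s \<Longrightarrow> s \<le> 1 \<Longrightarrow> (\<integral>\<^sup>+\<omega>. ennreal (s ^ Z n \<omega>) \<partial>M) = ennreal ((offspring_gf p ^^ n) s)"
proof (induction n arbitrary: s)
  case (Suc n)
  have top: "space M \<in> sets (alg (past n))" using sets.top[of "alg (past n)"] by simp
  have "(\<integral>\<^sup>+\<omega>. ennreal (s ^ Z (Suc n) \<omega>) \<partial>M) =
    (\<integral>\<^sup>+\<omega>. indicator (space M) \<omega> * ennreal (s ^ (\<Sum>i<Z n \<omega>. xi n i \<omega>)) \<partial>M)"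
    by (intro nn_integral_cong) simp
  also have "\<dots> = (\<integral>\<^sup>+\<omega>. indicator (space M) \<omega> * (\<integral>\<^sup>+\<omega>'. ennreal (s ^ (\<Sum>i<Z n \<omega>. xi n i \<omega>')) \<partial>M) \<partial>M)"
    by (rule nn_integral_random_index[OF top past_generation, of "\<lambda>j \<omega>. ennreal (s ^ (\<Sum>i<j. xi n i \<omega>))"])
       (rule measurable_compose[OF sum_xi_alg], simp)
  also have "\<dots> = (\<integral>\<^sup>+\<omega>. ennreal (offspring_gf p s ^ Z n \<omega>) \<partial>M)"
    by (intro nn_integral_cong) (simp add: nn_integral_power_sum_xi Suc.prems)
  also have "\<dots> = ennreal ((offspring_gf p ^^ n) (offspring_gf p s))"
    using Suc.prems gf_bounds by (intro Suc.IH) auto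
  finally show ?case by (simp add: funpow_swap1)
qed (simp add: emeasure_space_1)

lemma iterate_nonneg: "0 \<le> s \<Longrightarrow> s \<le> 1 \<Longrightarrow> 0 \<le> (offspring_gf p ^^ n) s \<and> (offspring_gf p ^^ n) s \<le> 1"
  by (induction n) (auto intro: gf_bounds)

lemma expectation_power_GW_pop:
  assumes "0 \<le> s" "s \<le> 1" shows "expectation (\<lambda>\<omega>. s ^ Z n \<omega>) = (offspring_gf p ^^ n) s"
  using assms iterate_nonneg
  by (intro integral_eq_nn_integral[THEN trans]) (simp_all add: nn_integral_power_GW_pop)

text \<open>The martingale property of \<open>Z n / m ^ n\<close>, tested on events of the past. In
  \<open>ennreal\<close> it presupposes no integrability of \<open>Z n\<close>, which is instead
  derived from it by induction.\<close>

lemma nn_integral_GW_pop_Suc: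
  assumes p_int: "integrable (measure_pmf p) real" and S: "S \<in> sets (alg (past n))"
  shows "(\<integral>\<^sup>+\<omega>. indicator S \<omega> * ennreal (real (Z (Suc n) \<omega>)) \<partial>M) =
    ennreal (offspring_mean p) * (\<integral>\<^sup>+\<omega>. indicator S \<omega> * ennreal (real (Z n \<omega>)) \<partial>M)"
proof -
  have [measurable]: "S \<in> sets M" using S sets_alg_subset by blast
  have m0: "0 \<le> offspring_mean p" by (simp add: offspring_mean_def)
  have c: "(\<integral>\<^sup>+\<omega>. ennreal (real (\<Sum>i<j. xi n i \<omega>)) \<partial>M) = ennreal (offspring_mean p) * ennreal (real j)" for j
  proof -
    have "(\<integral>\<^sup>+\<omega>. ennreal (real (\<Sum>i<j. xi n i \<omega>)) \<partial>M) = (\<integral>\<^sup>+\<omega>. (\<Sum>i<j. ennreal (real (xi n i \<omega>))) \<partial>M)"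
      by (intro nn_integral_cong) simp
    also have "\<dots> = (\<Sum>i<j. \<integral>\<^sup>+\<omega>. ennreal (real (xi n i \<omega>)) \<partial>M)"
      by (rule nn_integral_sum) simp
    also have "\<dots> = (\<Sum>i<j. ennreal (offspring_mean p))"
      unfolding nn_integral_xi[of "\<lambda>k. ennreal (real k)"] offspring_mean_def
      using p_int by (intro sum.cong nn_integral_eq_integral) auto
    finally show ?thesis using m0 by (simp add: mult.commute ennreal_of_nat_eq_real_of_nat)
  qed
  have "(\<integral>\<^sup>+\<omega>. indicator S \<omega> * ennreal (real (Z (Suc n) \<omega>)) \<partial>M) =
    (\<integral>\<^sup>+\<omega>. indicator S \<omega> * (\<integral>\<^sup>+\<omega>'. ennreal (real (\<Sum>i<Z n \<omega>. xi n i \<omega>')) \<partial>M) \<partial>M)"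
    unfolding GW_pop.simps
    by (rule nn_integral_random_index[OF S past_generation, of "\<lambda>j \<omega>. ennreal (real (\<Sum>i<j. xi n i \<omega>))"])
       (rule measurable_compose[OF sum_xi_alg], simp)
  also have "\<dots> = (\<integral>\<^sup>+\<omega>. ennreal (offspring_mean p) * (indicator S \<omega> * ennreal (real (Z n \<omega>))) \<partial>M)"
    unfolding c by (simp add: mult.left_commute)
  also have "\<dots> = ennreal (offspring_mean p) * (\<integral>\<^sup>+\<omega>. indicator S \<omega> * ennreal (real (Z n \<omega>)) \<partial>M)"
    by (rule nn_integral_cmult) measurable
  finally show ?thesis .
qed

lemma integrable_GW_pop:
  assumes p_int: "integrable (measure_pmf p) real"
  shows "integrable M (\<lambda>\<omega>. real (Z n \<omega>))"
proof (rule integrableI_nonneg)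
  show "(\<integral>\<^sup>+\<omega>. ennreal (real (Z n \<omega>)) \<partial>M) < \<infinity>"
  proof (induction n)
    case (Suc n)
    have top: "space M \<in> sets (alg (past n))" using sets.top[of "alg (past n)"] by simp
    have e: "(\<integral>\<^sup>+\<omega>. indicator (space M) \<omega> * h \<omega> \<partial>M) = (\<integral>\<^sup>+\<omega>. h \<omega> \<partial>M)" for h
      by (intro nn_integral_cong) simp
    show ?case using nn_integral_GW_pop_Suc[OF p_int top, unfolded e] Suc
      by (simp add: ennreal_mult_less_top del: GW_pop.simps)
  qed (simp add: emeasure_space_1)
qed auto

theorem GW_pop_limit:
  assumes p_int: "integrable (measure_pmf p) real" and m: "0 < offspring_mean p"
  shows "AE \<omega> in M. (\<lambda>n. real (Z n \<omega>) / offspring_mean p ^ n) \<longlonglongrightarrow> GW_limit xi (offspring_mean p) \<omega>"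
  unfolding GW_limit_def
proof (rule nonneg_martingale_convergence[where F="\<lambda>n. alg (past n)"])
  fix n k :: nat assume "k \<le> n"
  show "(\<lambda>\<omega>. real (Z k \<omega>) / offspring_mean p ^ k) \<in> borel_measurable (alg (past n))"
    by (rule measurable_compose[OF GW_pop_alg[OF \<open>k \<le> n\<close>]]) simp
next
  fix n show "integrable M (\<lambda>\<omega>. real (Z n \<omega>) / offspring_mean p ^ n)"
    using integrable_GW_pop[OF p_int] by simp
next
  fix n A assume A: "A \<in> sets (alg (past n))"
  have [measurable]: "A \<in> sets M" using A sets_alg_subset by blast
  have i: "integrable M (\<lambda>\<omega>. indicator A \<omega> * real (Z k \<omega>))" for k
    using integrable_mult_indicator[OF \<open>A \<in> sets M\<close> integrable_GW_pop[OF p_int, of k]] by simp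
  have nn: "(\<integral>\<^sup>+\<omega>. indicator A \<omega> * ennreal (real (Z k \<omega>)) \<partial>M) = ennreal (expectation (\<lambda>\<omega>. indicator A \<omega> * real (Z k \<omega>)))" for k
    by (subst nn_integral_eq_integral[OF i, symmetric]) (auto intro!: nn_integral_cong simp: indicator_def)
  have "expectation (\<lambda>\<omega>. indicator A \<omega> * real (Z (Suc n) \<omega>)) = offspring_mean p * expectation (\<lambda>\<omega>. indicator A \<omega> * real (Z n \<omega>))"
    using nn_integral_GW_pop_Suc[OF p_int A, unfolded nn] m
    by (subst (asm) ennreal_mult[symmetric]) (auto simp del: GW_pop.simps)
  thus "expectation (\<lambda>\<omega>. indicator A \<omega> * (real (Z (Suc n) \<omega>) / offspring_mean p ^ Suc n)) =
    expectation (\<lambda>\<omega>. indicator A \<omega> * (real (Z n \<omega>) / offspring_mean p ^ n))"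
    using m by (simp del: GW_pop.simps)
qed (use m sets_alg_subset in auto)

section \<open>Averaging the walk over the population size\<close>

definition walk_tail :: "real \<Rightarrow> nat \<Rightarrow> real" where
  "walk_tail x j = prob {\<omega> \<in> space M. real j * x \<le> partial_sum X j \<omega>}"

lemma walk_tail_bounds: "0 \<le> walk_tail x j" "walk_tail x j \<le> 1"
  by (simp_all add: walk_tail_def)

lemma partial_sum_alg: "partial_sum X j \<in> borel_measurable (alg (range Inr))"
proof -
  have [measurable]: "X i \<in> borel_measurable (alg (range Inr))" for i by (rule X_alg) auto
  show ?thesis unfolding partial_sum_def[abs_def] by measurable
qed

text \<open>The walk lives on the \<open>Inr\<close> coordinates, disjoint from
  \<open>past n\<close>, so \<open>nn_integral_random_index\<close> applies. Positivity of
  \<open>Z n\<close> allows the division to be multiplied out.\<close>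

lemma R_tail_eq:
  assumes pos: "AE \<omega> in M. 0 < Z n \<omega>"
  shows "R_tail M xi X n x = expectation (\<lambda>\<omega>. walk_tail x (Z n \<omega>))"
proof -
  have [measurable]: "partial_sum X j \<in> borel_measurable M" for j
    by (rule measurable_from_alg[OF partial_sum_alg])
  have top: "space M \<in> sets (alg (past n))" using sets.top[of "alg (past n)"] by simp
  let ?E = "\<lambda>j. {\<omega> \<in> space M. real j * x \<le> partial_sum X j \<omega>}"
  have E: "?E j \<in> sets (alg (range Inr))" for j
    using measurable_sets[OF partial_sum_alg[of j], of "{real j * x..}"] by (simp add: vimage_def Int_def conj_commute)
  have [measurable]: "(\<lambda>\<omega>. partial_sum X (Z n \<omega>) \<omega>) \<in> borel_measurable M"
    by (rule measurable_compose_countable[OF _ GW_pop_measurable]) simp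
  have "emeasure M {\<omega> \<in> space M. Z n \<omega> > 0 \<and> partial_sum X (Z n \<omega>) \<omega> / real (Z n \<omega>) \<ge> x} =
    emeasure M {\<omega> \<in> space M. real (Z n \<omega>) * x \<le> partial_sum X (Z n \<omega>) \<omega>}"
    by (rule emeasure_eq_AE) (use pos in \<open>auto simp: field_simps elim: eventually_mono\<close>)
  also have "\<dots> = (\<integral>\<^sup>+\<omega>. indicator (space M) \<omega> * indicator (?E (Z n \<omega>)) \<omega> \<partial>M)"
  proof -
    have "emeasure M {\<omega> \<in> space M. real (Z n \<omega>) * x \<le> partial_sum X (Z n \<omega>) \<omega>} =
      (\<integral>\<^sup>+\<omega>. indicator {\<omega> \<in> space M. real (Z n \<omega>) * x \<le> partial_sum X (Z n \<omega>) \<omega>} \<omega> \<partial>M)"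
      by (rule nn_integral_indicator[symmetric]) measurable
    also have "\<dots> = (\<integral>\<^sup>+\<omega>. indicator (space M) \<omega> * indicator (?E (Z n \<omega>)) \<omega> \<partial>M)"
      by (intro nn_integral_cong) (simp add: indicator_def)
    finally show ?thesis .
  qed
  also have "\<dots> = (\<integral>\<^sup>+\<omega>. indicator (space M) \<omega> * (\<integral>\<^sup>+\<omega>'. indicator (?E (Z n \<omega>)) \<omega>' \<partial>M) \<partial>M)"
    by (rule nn_integral_random_index[OF top past_X, of "\<lambda>j. indicator (?E j)"]) (use E in simp)
  also have "\<dots> = (\<integral>\<^sup>+\<omega>. ennreal (walk_tail x (Z n \<omega>)) \<partial>M)"
    by (intro nn_integral_cong) (simp add: walk_tail_def emeasure_eq_measure)
  also have "\<dots> = ennreal (expectation (\<lambda>\<omega>. walk_tail x (Z n \<omega>)))"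
    using walk_tail_bounds
    by (intro nn_integral_eq_integral integrable_const_bound[where B=1] measurable_compose[OF GW_pop_measurable]) auto
  finally show ?thesis unfolding R_tail_def
    by (simp add: emeasure_eq_measure walk_tail_def)
qed

text \<open>Every individual has at least two children. The crude linear growth is enough to keep
  \<open>Z n\<close> positive and to bring it above any fixed threshold.\<close>

lemma GW_pop_ge:
  assumes "pmf p 0 = 0" "pmf p 1 = 0"
  shows "AE \<omega> in M. \<forall>n. Suc n \<le> Z n \<omega>"
proof -
  have "AE \<omega> in M. 2 \<le> xi n i \<omega>" for n i
  proof -
    have "AE k in measure_pmf p. 2 \<le> k"
    proof (subst AE_measure_pmf_iff, rule ballI)
      fix k assume "k \<in> set_pmf p"
      hence "k \<noteq> 0" "k \<noteq> 1" using assms by (metis set_pmf_iff)+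
      thus "2 \<le> k" by simp
    qed
    thus ?thesis unfolding xi_distr[symmetric, of n i] by (subst (asm) AE_distr_iff) auto
  qed
  hence "AE \<omega> in M. \<forall>n i. 2 \<le> xi n i \<omega>" by (simp add: AE_all_countable)
  thus ?thesis
  proof eventually_elim
    case (elim \<omega>)
    show ?case
    proof
      fix n show "Suc n \<le> Z n \<omega>"
      proof (induction n)
        case (Suc n)
        have "(\<Sum>i<Z n \<omega>. 2) \<le> (\<Sum>i<Z n \<omega>. xi n i \<omega>)" by (intro sum_mono) (use elim in simp)
        thus ?case using Suc by simp
      qed simp
    qed
  qed
qed

lemma indep_X: "indep_vars (\<lambda>_. borel) X UNIV"
proof -
  have "indep_vars (\<lambda>j. PiM {Inr j} (\<lambda>_. borel)) (\<lambda>j \<omega>. restrict (\<lambda>i. coord i \<omega>) {Inr j}) (UNIV :: nat set)"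
    by (rule indep_vars_restrict[OF indep_coord]) (auto simp: disjoint_family_on_def)
  from indep_vars_compose2[OF this, of "\<lambda>j x. x (Inr j)" "\<lambda>_. borel"]
  show ?thesis by (simp add: coord_def)
qed

end

section \<open>Tails of the random walk\<close>

text \<open>The Taylor remainder is at most
  \<open>exp \<bar>t * x\<bar> * \<bar>t * x\<bar> ^ 3 / 6\<close>. Because
  \<open>t \<le> h / 2\<close>, one half of the exponent \<open>h * \<bar>x\<bar>\<close> absorbs
  the exponential, and the other half the cube, through
  \<open>y ^ 3 / 6 \<le> exp y\<close>.\<close>

lemma exp_le_cubic_remainder:
  fixes x h t :: real
  assumes h: "0 < h" and t: "0 \<le> t" "t \<le> h / 2"
  shows "exp (t * x) \<le> 1 + t * x + t\<^sup>2 / 2 * x\<^sup>2 + t ^ 3 * ((2 / h) ^ 3 * exp (h * \<bar>x\<bar>))"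
proof -
  define y where "y = h * \<bar>x\<bar> / 2"
  have y: "0 \<le> y" using h by (simp add: y_def)
  obtain z where z: "exp y = (\<Sum>m<4. y ^ m / fact m) + exp z / fact 4 * y ^ 4"
    using Maclaurin_exp_le[of y 4] by auto
  have "0 \<le> exp z / fact 4 * y ^ 4" using y by simp
  hence y3: "y ^ 3 / 6 \<le> exp y"
    using y unfolding z by (simp add: eval_nat_numeral)
  obtain v where v: "\<bar>v\<bar> \<le> \<bar>t * x\<bar>" "exp (t * x) = (\<Sum>m<3. (t * x) ^ m / fact m) + exp v / fact 3 * (t * x) ^ 3"
    using Maclaurin_exp_le[of "t * x" 3] by blast
  have "\<bar>t * x\<bar> \<le> y" using t mult_right_mono[of t "h / 2" "\<bar>x\<bar>"] by (simp add: abs_mult y_def)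
  hence "exp v \<le> exp y" using v(1) by simp
  have "exp v / fact 3 * (t * x) ^ 3 \<le> exp y / fact 3 * (t * \<bar>x\<bar>) ^ 3"
  proof -
    have "exp v / fact 3 * (t * x) ^ 3 \<le> exp v / fact 3 * \<bar>t * x\<bar> ^ 3"
      by (intro mult_left_mono) (auto simp: power_abs[symmetric])
    also have "\<dots> \<le> exp y / fact 3 * \<bar>t * x\<bar> ^ 3"
      using \<open>exp v \<le> exp y\<close> by (intro mult_right_mono divide_right_mono) auto
    finally show ?thesis using t by (simp add: abs_mult)
  qed
  also have "\<dots> = t ^ 3 * ((2 / h) ^ 3 * (exp y * (y ^ 3 / 6)))"
    using h by (simp add: y_def power_mult_distrib power_divide fact_numeral field_simps)
  also have "\<dots> \<le> t ^ 3 * ((2 / h) ^ 3 * (exp y * exp y))"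
    using y3 t h by (intro mult_left_mono) auto
  also have "exp y * exp y = exp (h * \<bar>x\<bar>)" by (simp add: y_def flip: exp_add)
  finally show ?thesis unfolding v(2) by (simp add: eval_nat_numeral power_mult_distrib)
qed

text \<open>On the unit interval \<open>{y<..y+1}\<close> the density is least at the right end.
  Passing from \<open>y\<close> to \<open>y + 1\<close> changes the exponent only by a term linear
  in \<open>y\<close>, which is negligible at the scale used later.\<close>

lemma std_normal_cdf_tail:
  assumes "0 \<le> y"
  shows "std_normal_density (y + 1) \<le> 1 - cdf std_normal_distribution y"
    and "isCont (cdf std_normal_distribution) y"
proof -
  interpret N: real_distribution std_normal_distribution by (rule real_dist_normal_dist)
  have "emeasure std_normal_distribution {y} = 0"
    by (subst emeasure_density) (auto simp: nn_integral_0_iff_AE intro!: AE_I[where N="{y}"])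
  thus "isCont (cdf std_normal_distribution) y"
    by (simp add: N.isCont_cdf measure_def)
  have "ennreal (std_normal_density (y + 1)) = (\<integral>\<^sup>+x. ennreal (std_normal_density (y + 1)) * indicator {y<..y+1} x \<partial>lborel)"
    by (subst nn_integral_cmult_indicator) auto
  also have "\<dots> \<le> (\<integral>\<^sup>+x. ennreal (std_normal_density x) * indicator {y<..y+1} x \<partial>lborel)"
  proof (intro nn_integral_mono)
    fix x :: real
    show "ennreal (std_normal_density (y + 1)) * indicator {y<..y+1} x \<le> ennreal (std_normal_density x) * indicator {y<..y+1} x"
    proof (cases "x \<in> {y<..y+1}")
      case True
      hence "x\<^sup>2 \<le> (y + 1)\<^sup>2" using assms by (intro power_mono) auto
      hence "std_normal_density (y + 1) \<le> std_normal_density x"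
        unfolding std_normal_density_def by (intro mult_left_mono) auto
      thus ?thesis using True by (simp add: ennreal_leI)
    qed simp
  qed
  also have "\<dots> = emeasure std_normal_distribution {y<..y+1}"
    by (subst emeasure_density) auto
  also have "\<dots> \<le> emeasure std_normal_distribution {y<..}" by (intro emeasure_mono) auto
  also have "\<dots> = ennreal (measure std_normal_distribution {y<..})" by (simp add: N.emeasure_eq_measure)
  finally have "std_normal_density (y + 1) \<le> measure std_normal_distribution {y<..}" by simp
  also have "{y<..} = UNIV - {..y}" by auto
  also have "measure std_normal_distribution (UNIV - {..y}) = 1 - cdf std_normal_distribution y"
    using N.prob_compl[of "{..y}"] by (simp add: cdf_def)
  finally show "std_normal_density (y + 1) \<le> 1 - cdf std_normal_distribution y" .
qed

section \<open>Chernoff bound and block argument for the walk\<close>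

locale GW_walk_exp = GW_walk +
  assumes X_sq_int: "integrable M (\<lambda>\<omega>. (X 0 \<omega>)\<^sup>2)"
    and X_mean: "expectation (X 0) = 0"
    and X_var_pos: "expectation (\<lambda>\<omega>. (X 0 \<omega>)\<^sup>2) > 0"
    and X_exp: "\<exists>h>0. integrable M (\<lambda>\<omega>. exp (h * \<bar>X 0 \<omega>\<bar>))"
begin

definition \<sigma>2 :: real where "\<sigma>2 = expectation (\<lambda>\<omega>. (X 0 \<omega>)\<^sup>2)"

lemma \<sigma>2_pos: "\<sigma>2 > 0" using X_var_pos by (simp add: \<sigma>2_def)

lemma X_int: "integrable M (X 0)"
  by (rule square_integrable_imp_integrable[OF _ X_sq_int]) simp

lemma transfer_X:
  fixes h :: "real \<Rightarrow> real"
  assumes [measurable]: "h \<in> borel_measurable borel"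
  shows "expectation (\<lambda>\<omega>. h (X j \<omega>)) = expectation (\<lambda>\<omega>. h (X 0 \<omega>))"
    and "integrable M (\<lambda>\<omega>. h (X j \<omega>)) \<longleftrightarrow> integrable M (\<lambda>\<omega>. h (X 0 \<omega>))"
proof -
  have "expectation (\<lambda>\<omega>. h (X i \<omega>)) = integral\<^sup>L (distr M borel (X i)) h"
    "integrable M (\<lambda>\<omega>. h (X i \<omega>)) \<longleftrightarrow> integrable (distr M borel (X i)) h" for i
    by (simp_all add: integral_distr integrable_distr_eq)
  thus "expectation (\<lambda>\<omega>. h (X j \<omega>)) = expectation (\<lambda>\<omega>. h (X 0 \<omega>))"
    "integrable M (\<lambda>\<omega>. h (X j \<omega>)) \<longleftrightarrow> integrable M (\<lambda>\<omega>. h (X 0 \<omega>))"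
    using X_distr[of j] by simp_all
qed

text \<open>The linear term vanishes with the mean, and for small \<open>t\<close> the cubic
  remainder is at most a fraction \<open>\<delta>\<close> of the quadratic term.\<close>

lemma mgf_bound:
  assumes \<delta>: "\<delta> > 0"
  obtains t0 where "t0 > 0" "\<And>t. 0 < t \<Longrightarrow> t \<le> t0 \<Longrightarrow> integrable M (\<lambda>\<omega>. exp (t * X 0 \<omega>))"
    "\<And>t. 0 < t \<Longrightarrow> t \<le> t0 \<Longrightarrow> expectation (\<lambda>\<omega>. exp (t * X 0 \<omega>)) \<le> exp ((1 + \<delta>) * \<sigma>2 * t\<^sup>2 / 2)"
proof -
  obtain h where h: "h > 0" and hi: "integrable M (\<lambda>\<omega>. exp (h * \<bar>X 0 \<omega>\<bar>))" using X_exp by blast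
  define K where "K = (2 / h) ^ 3 * expectation (\<lambda>\<omega>. exp (h * \<bar>X 0 \<omega>\<bar>))"
  have K: "K \<ge> 0" using h by (simp add: K_def)
  \<comment> \<open>The first bound admits \<open>exp_le_cubic_remainder\<close>; the second gives
    \<open>t * K \<le> \<delta> * \<sigma>2 / 2\<close>, with \<open>+ 1\<close> keeping the divisor
    positive.\<close>
  define t0 where "t0 = min (h / 2) (\<delta> * \<sigma>2 / 2 / (K + 1))"
  have t0: "t0 > 0" using h \<delta> \<sigma>2_pos K by (simp add: t0_def)
  have int: "integrable M (\<lambda>\<omega>. exp (t * X 0 \<omega>))" if "0 < t" "t \<le> t0" for t
  proof (rule Bochner_Integration.integrable_bound[OF hi])
    have "t * X 0 \<omega> \<le> h * \<bar>X 0 \<omega>\<bar>" for \<omega>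
    proof -
      have "t \<le> h" using that h by (simp add: t0_def)
      have "t * X 0 \<omega> \<le> t * \<bar>X 0 \<omega>\<bar>" using that by (intro mult_left_mono) auto
      also have "\<dots> \<le> h * \<bar>X 0 \<omega>\<bar>" using \<open>t \<le> h\<close> by (intro mult_right_mono) auto
      finally show ?thesis .
    qed
    thus "AE \<omega> in M. norm (exp (t * X 0 \<omega>)) \<le> norm (exp (h * \<bar>X 0 \<omega>\<bar>))" by simp
  qed simp
  moreover have "expectation (\<lambda>\<omega>. exp (t * X 0 \<omega>)) \<le> exp ((1 + \<delta>) * \<sigma>2 * t\<^sup>2 / 2)" if t: "0 < t" "t \<le> t0" for t
  proof -
    have "expectation (\<lambda>\<omega>. exp (t * X 0 \<omega>)) \<le>
      expectation (\<lambda>\<omega>. 1 + t * X 0 \<omega> + t\<^sup>2 / 2 * (X 0 \<omega>)\<^sup>2 + t ^ 3 * ((2 / h) ^ 3 * exp (h * \<bar>X 0 \<omega>\<bar>)))"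
      using t h by (intro integral_mono int exp_le_cubic_remainder Bochner_Integration.integrable_add
          integrable_mult_right X_int X_sq_int hi integrable_const) (auto simp: t0_def)
    also have "\<dots> = 1 + t * expectation (X 0) + t\<^sup>2 / 2 * \<sigma>2 + t ^ 3 * K"
      using X_int X_sq_int hi by (simp add: \<sigma>2_def K_def prob_space)
    also have "\<dots> = 1 + t\<^sup>2 * (\<sigma>2 / 2 + t * K)"
      by (simp add: X_mean algebra_simps power2_eq_square power3_eq_cube)
    also have "\<dots> \<le> 1 + t\<^sup>2 * ((1 + \<delta>) * \<sigma>2 / 2)"
    proof -
      have "t * K \<le> t * (K + 1)" using t by simp
      also have "\<dots> \<le> \<delta> * \<sigma>2 / 2"
        using t(2) K by (simp add: t0_def pos_le_divide_eq algebra_simps)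
      finally have "\<sigma>2 / 2 + t * K \<le> (1 + \<delta>) * \<sigma>2 / 2" by (simp add: algebra_simps)
      thus ?thesis by (intro add_left_mono mult_left_mono) auto
    qed
    also have "\<dots> \<le> exp (t\<^sup>2 * ((1 + \<delta>) * \<sigma>2 / 2))" by (rule exp_ge_add_one_self)
    finally show ?thesis by (simp add: mult_ac)
  qed
  ultimately show ?thesis using that[OF t0] by blast
qed

lemma walk_tail_upper:
  assumes \<delta>: "\<delta> > 0"
  obtains \<epsilon>0 where "\<epsilon>0 > 0"
    "\<And>\<epsilon> j. 0 < \<epsilon> \<Longrightarrow> \<epsilon> \<le> \<epsilon>0 \<Longrightarrow> walk_tail \<epsilon> j \<le> exp (- ((1 - \<delta>) / (2 * \<sigma>2)) * \<epsilon>\<^sup>2) ^ j"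
proof -
  obtain t0 where t0: "t0 > 0" "\<And>t. 0 < t \<Longrightarrow> t \<le> t0 \<Longrightarrow> integrable M (\<lambda>\<omega>. exp (t * X 0 \<omega>))"
    "\<And>t. 0 < t \<Longrightarrow> t \<le> t0 \<Longrightarrow> expectation (\<lambda>\<omega>. exp (t * X 0 \<omega>)) \<le> exp ((1 + \<delta>) * \<sigma>2 * t\<^sup>2 / 2)"
    using mgf_bound[OF \<delta>] by blast
  have "walk_tail \<epsilon> j \<le> exp (- ((1 - \<delta>) / (2 * \<sigma>2)) * \<epsilon>\<^sup>2) ^ j" if e: "0 < \<epsilon>" "\<epsilon> \<le> t0 * \<sigma>2" for \<epsilon> j
  proof -
    \<comment> \<open>The minimiser of \<open>- t * \<epsilon> + \<sigma>2 * t\<^sup>2 / 2\<close>,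
      the Chernoff exponent without \<open>\<delta>\<close>.\<close>
    define t where "t = \<epsilon> / \<sigma>2"
    have t: "0 < t" "t \<le> t0" using e \<sigma>2_pos by (auto simp: t_def field_simps)
    have ind: "indep_vars (\<lambda>_. borel) (\<lambda>i \<omega>. exp (t * X i \<omega>)) {..<j}"
      by (rule indep_vars_compose2[OF indep_vars_subset[OF indep_X]]) auto
    have i1: "integrable M (\<lambda>\<omega>. exp (t * X i \<omega>))" for i
      using transfer_X(2)[of "\<lambda>x. exp (t * x)" i] t0(2)[OF t] by simp
    have e1: "expectation (\<lambda>\<omega>. exp (t * X i \<omega>)) = expectation (\<lambda>\<omega>. exp (t * X 0 \<omega>))" for i
      using transfer_X(1)[of "\<lambda>x. exp (t * x)" i] by simp
    have eS: "exp (t * partial_sum X j \<omega>) = (\<Prod>i<j. exp (t * X i \<omega>))" for \<omega>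
      by (simp add: partial_sum_def sum_distrib_left exp_sum)
    have iS: "integrable M (\<lambda>\<omega>. exp (t * partial_sum X j \<omega>))"
      unfolding eS by (rule indep_vars_integrable[OF _ ind i1]) auto
    have "walk_tail \<epsilon> j \<le> exp (- t * (real j * \<epsilon>)) * (\<integral>\<omega>\<in>space M. exp (t * partial_sum X j \<omega>) \<partial>M)"
      unfolding walk_tail_def
      by (rule Chernoff_ineq_ge[OF t(1)]) (use integrable_mult_indicator[OF sets.top iS] in \<open>auto simp: set_integrable_def\<close>)
    also have "(\<integral>\<omega>\<in>space M. exp (t * partial_sum X j \<omega>) \<partial>M) = expectation (\<lambda>\<omega>. exp (t * partial_sum X j \<omega>))"
      by (rule set_integral_space[OF iS])
    also have "\<dots> = expectation (\<lambda>\<omega>. exp (t * X 0 \<omega>)) ^ j"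
    proof -
      have "expectation (\<lambda>\<omega>. exp (t * partial_sum X j \<omega>)) = (\<Prod>i<j. expectation (\<lambda>\<omega>. exp (t * X i \<omega>)))"
        unfolding eS by (rule indep_vars_lebesgue_integral[OF _ ind i1]) auto
      also have "\<dots> = (\<Prod>i<j. expectation (\<lambda>\<omega>. exp (t * X 0 \<omega>)))" by (rule prod.cong[OF refl e1])
      finally show ?thesis by simp
    qed
    also have "\<dots> \<le> exp ((1 + \<delta>) * \<sigma>2 * t\<^sup>2 / 2) ^ j"
      by (intro power_mono t0(3)[OF t]) (auto intro: Bochner_Integration.integral_nonneg)
    also have "exp (- t * (real j * \<epsilon>)) * exp ((1 + \<delta>) * \<sigma>2 * t\<^sup>2 / 2) ^ j =
      exp (- t * \<epsilon> + (1 + \<delta>) * \<sigma>2 * t\<^sup>2 / 2) ^ j"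
      by (simp add: exp_of_nat_mult[symmetric] exp_add[symmetric] algebra_simps)
    also have "- t * \<epsilon> + (1 + \<delta>) * \<sigma>2 * t\<^sup>2 / 2 = - ((1 - \<delta>) / (2 * \<sigma>2)) * \<epsilon>\<^sup>2"
      using \<sigma>2_pos by (simp add: t_def field_simps power2_eq_square)
    finally show ?thesis by simp
  qed
  thus ?thesis using that[of "t0 * \<sigma>2"] t0(1) \<sigma>2_pos by simp
qed

text \<open>If the averages over two consecutive independent blocks reach \<open>x\<close>, so does
  the overall average. The second block has the law of \<open>partial_sum X b\<close> because its
  characteristic function depends only on its length.\<close>

lemma walk_tail_supermult: "walk_tail x a * walk_tail x b \<le> walk_tail x (a + b)"
proof -
  let ?I = "Inr ` {..<a}" and ?J = "Inr ` {a..<a+b}"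
  let ?T = "\<lambda>\<omega>. \<Sum>i\<in>{a..<a+b}. X i \<omega>"
  have [measurable]: "X i \<in> borel_measurable (alg ?I)" if "i \<in> {..<a}" for i using that by (intro X_alg) auto
  have [measurable]: "X i \<in> borel_measurable (alg ?J)" if "i \<in> {a..<a+b}" for i using that by (intro X_alg) auto
  have ind: "indep_var borel (partial_sum X a) borel ?T"
    by (rule indep_alg[of ?I ?J]) (auto simp: partial_sum_def[abs_def])
  have [measurable]: "partial_sum X k \<in> borel_measurable M" for k
    by (rule measurable_from_alg[OF partial_sum_alg])
  have char_sum: "char (distr M borel (\<lambda>\<omega>. \<Sum>i\<in>A. X i \<omega>)) t = char (distr M borel (X 0)) t ^ card A" for A t
  proof -
    have "char (distr M borel (\<lambda>\<omega>. \<Sum>i\<in>A. X i \<omega>)) t = (\<Prod>i\<in>A. char (distr M borel (X i)) t)"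
      by (rule char_distr_sum[OF indep_vars_subset[OF indep_X]]) auto
    also have "\<dots> = (\<Prod>i\<in>A. char (distr M borel (X 0)) t)"
      by (rule prod.cong[OF refl]) (metis X_distr)
    finally show ?thesis by simp
  qed
  have "distr M borel ?T = distr M borel (partial_sum X b)"
    unfolding partial_sum_def[abs_def]
    by (intro Levy_uniqueness real_distribution_distr ext) (simp_all add: char_sum)
  hence T: "prob {\<omega> \<in> space M. ?T \<omega> \<in> {real b * x..}} = prob {\<omega> \<in> space M. partial_sum X b \<omega> \<in> {real b * x..}}"
    using measure_distr[of ?T M borel "{real b * x..}"] measure_distr[of "partial_sum X b" M borel "{real b * x..}"]
    by (simp add: vimage_def Int_def conj_commute)
  have "walk_tail x a * walk_tail x b = prob {\<omega> \<in> space M. partial_sum X a \<omega> \<in> {real a * x..}} *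
     prob {\<omega> \<in> space M. ?T \<omega> \<in> {real b * x..}}"
    unfolding T by (simp add: walk_tail_def)
  also have "\<dots> = prob {\<omega> \<in> space M. partial_sum X a \<omega> \<in> {real a * x..} \<and> ?T \<omega> \<in> {real b * x..}}"
    by (rule prob_indep_random_variable[OF ind, symmetric]) auto
  also have "\<dots> \<le> walk_tail x (a + b)"
    unfolding walk_tail_def
  proof (intro finite_measure_mono subsetI)
    fix \<omega> assume "\<omega> \<in> {\<omega> \<in> space M. partial_sum X a \<omega> \<in> {real a * x..} \<and> ?T \<omega> \<in> {real b * x..}}"
    moreover have "partial_sum X (a + b) \<omega> = partial_sum X a \<omega> + ?T \<omega>"
      unfolding partial_sum_def lessThan_atLeast0 by (rule sum.atLeastLessThan_concat[symmetric]) auto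
    ultimately show "\<omega> \<in> {\<omega> \<in> space M. real (a + b) * x \<le> partial_sum X (a + b) \<omega>}"
      by (simp add: algebra_simps)
  qed measurable
  finally show ?thesis .
qed

text \<open>One \<open>N\<close> serves all levels \<open>x\<close> at once: when
  \<open>k * x\<^sup>2 \<le> \<sigma>2 * y\<^sup>2\<close>, the event that the normalised sum
  exceeds \<open>y\<close> is contained in the event counted by
  \<open>walk_tail x k\<close>.\<close>

lemma clt_lower:
  assumes y: "0 \<le> y" and c: "c < std_normal_density (y + 1)"
  obtains N where "N > 0" "\<And>k x. N \<le> k \<Longrightarrow> 0 \<le> x \<Longrightarrow> real k * x\<^sup>2 \<le> \<sigma>2 * y\<^sup>2 \<Longrightarrow> c \<le> walk_tail x k"
proof -
  have [measurable]: "partial_sum X k \<in> borel_measurable M" for k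
    by (rule measurable_from_alg[OF partial_sum_alg])
  let ?D = "\<lambda>n. distr M borel (\<lambda>\<omega>. (\<Sum>i<n. X i \<omega>) / sqrt (real n * (sqrt \<sigma>2)\<^sup>2))"
  have mean: "expectation (X n) = 0" for n using transfer_X(1)[of "\<lambda>x. x" n] X_mean by simp
  have var: "variance (X n) = (sqrt \<sigma>2)\<^sup>2" for n
    using transfer_X(1)[of "\<lambda>x. x\<^sup>2" n] \<sigma>2_pos by (simp add: mean \<sigma>2_def)
  have "weak_conv_m ?D std_normal_distribution"
    by (rule central_limit_theorem_zero_mean[OF indep_X mean _ _ var X_distr])
       (use \<sigma>2_pos transfer_X(2)[of "\<lambda>x. x\<^sup>2"] X_sq_int in auto)
  hence "(\<lambda>n. cdf (?D n) y) \<longlonglongrightarrow> cdf std_normal_distribution y"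
    using std_normal_cdf_tail(2)[OF y] by (simp add: weak_conv_m_def weak_conv_def)
  moreover have "cdf std_normal_distribution y < 1 - c" using std_normal_cdf_tail(1)[OF y] c by simp
  ultimately have "\<forall>\<^sub>F n in sequentially. cdf (?D n) y < 1 - c" by (rule order_tendstoD(2))
  then obtain N where N: "\<And>n. N \<le> n \<Longrightarrow> cdf (?D n) y < 1 - c" unfolding eventually_sequentially by blast
  show ?thesis
  proof (rule that[of "Suc N"])
    fix k x assume k: "Suc N \<le> k" and x: "0 \<le> x" and kx: "real k * x\<^sup>2 \<le> \<sigma>2 * y\<^sup>2"
    let ?A = "{\<omega> \<in> space M. partial_sum X k \<omega> / sqrt (real k * \<sigma>2) \<le> y}"
    have "cdf (?D k) y = prob ?A"
      unfolding cdf_def using \<sigma>2_pos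
      by (subst measure_distr) (auto simp: partial_sum_def vimage_def Int_def conj_commute)
    hence "c \<le> 1 - prob ?A" using N[of k] k by simp
    also have "\<dots> = prob (space M - ?A)" by (rule prob_compl[symmetric]) measurable
    also have "\<dots> \<le> walk_tail x k" unfolding walk_tail_def
    proof (intro finite_measure_mono subsetI)
      fix \<omega> assume w: "\<omega> \<in> space M - ?A"
      have k0: "real k > 0" using k by simp
      have "real k * x = sqrt (real k * (real k * x\<^sup>2))" using k0 x by (simp add: real_sqrt_mult)
      also have "\<dots> \<le> sqrt (real k * (\<sigma>2 * y\<^sup>2))" using kx k0 by (intro real_sqrt_le_mono mult_left_mono) auto
      also have "\<dots> = y * sqrt (real k * \<sigma>2)" using y by (simp add: real_sqrt_mult)
      also have "\<dots> \<le> partial_sum X k \<omega>" using w k0 \<sigma>2_pos by (auto simp: not_le pos_less_divide_eq)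
      finally show "\<omega> \<in> {\<omega> \<in> space M. real k * x \<le> partial_sum X k \<omega>}" using w by simp
    qed measurable
    finally show "c \<le> walk_tail x k" .
  qed simp
qed

text \<open>Blocks of length \<open>b \<approx> K / \<epsilon>\<^sup>2\<close> are in the range of the central limit theorem, where the
  Gaussian tail has the right exponential rate once \<open>K\<close> is large; superadditivity then
  handles longer walks.\<close>
lemma walk_tail_lower:
  assumes \<delta>: "\<delta> > 0"
  obtains c \<epsilon>0 n0 where "c > 0" "\<epsilon>0 > 0"
    "\<And>\<epsilon> k. 0 < \<epsilon> \<Longrightarrow> \<epsilon> \<le> \<epsilon>0 \<Longrightarrow> n0 \<le> k \<Longrightarrow> c * exp (- ((1 + \<delta>) / (2 * \<sigma>2)) * \<epsilon>\<^sup>2) ^ k \<le> walk_tail \<epsilon> k"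
proof -
  \<comment> \<open>Rounding the block length up can raise \<open>b * \<epsilon>\<^sup>2\<close>
    from \<open>K = \<sigma>2 * (y\<^sup>2 - 1)\<close> to at most
    \<open>\<sigma>2 * y\<^sup>2\<close>. So the Gaussian tail at \<open>y\<close> must beat the
    rate at \<open>y\<^sup>2 - 1\<close>; for large \<open>y\<close> the surplus
    \<open>\<delta> / 2 * y\<^sup>2\<close> outweighs the linear loss.\<close>
  have "\<forall>\<^sub>F y in at_top. exp (- (1 + \<delta>) * (y\<^sup>2 - 1) / 2) < 1 / sqrt (2 * pi) * exp (- (y + 1)\<^sup>2 / 2)"
  proof -
    have "filterlim (\<lambda>y. \<delta> / 2 * y\<^sup>2 - y - (2 + \<delta>) / 2) at_top at_top" using \<delta> by real_asymp
    hence "\<forall>\<^sub>F y in at_top. ln (sqrt (2 * pi)) < \<delta> / 2 * y\<^sup>2 - y - (2 + \<delta>) / 2"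
      unfolding filterlim_at_top_dense by blast
    thus ?thesis
    proof eventually_elim
      case (elim y)
      have "exp (- (1 + \<delta>) * (y\<^sup>2 - 1) / 2) < exp (- (y + 1)\<^sup>2 / 2 - ln (sqrt (2 * pi)))"
        using elim by (simp add: field_simps power2_eq_square)
      also have "\<dots> = 1 / sqrt (2 * pi) * exp (- (y + 1)\<^sup>2 / 2)" by (simp add: exp_diff)
      finally show ?case .
    qed
  qed
  with eventually_gt_at_top[of "1::real"]
  have "\<forall>\<^sub>F y in at_top. 1 < y \<and> exp (- (1 + \<delta>) * (y\<^sup>2 - 1) / 2) < std_normal_density (y + 1)"
    unfolding std_normal_density_def by eventually_elim simp
  then obtain y where y: "1 < y" "exp (- (1 + \<delta>) * (y\<^sup>2 - 1) / 2) < std_normal_density (y + 1)"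
    using eventually_happens[of _ "at_top :: real filter"] by auto
  have y0: "0 \<le> y" using y(1) by simp
  obtain N1 where N1: "N1 > 0" "\<And>k x. N1 \<le> k \<Longrightarrow> 0 \<le> x \<Longrightarrow> real k * x\<^sup>2 \<le> \<sigma>2 * y\<^sup>2 \<Longrightarrow>
      exp (- (1 + \<delta>) * (y\<^sup>2 - 1) / 2) \<le> walk_tail x k"
    using clt_lower[OF y0 y(2)] by blast
  \<comment> \<open>Leftover walks are shorter than \<open>2 * b\<close>, so
    \<open>k * \<epsilon>\<^sup>2\<close> can reach
    \<open>2 * \<sigma>2 * y\<^sup>2 = \<sigma>2 * y'\<^sup>2\<close>. They are used once only and
    may cost a constant \<open>c\<close>.\<close>
  define y' where "y' = sqrt 2 * y"
  have y'0: "0 \<le> y'" using y by (simp add: y'_def)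
  define c where "c = std_normal_density (y' + 1) / 2"
  have c0: "c > 0" by (simp add: c_def normal_density_pos)
  have "c < std_normal_density (y' + 1)" using c0 by (simp add: c_def)
  from clt_lower[OF y'0 this] obtain N2 where N2: "N2 > 0"
    "\<And>k x. N2 \<le> k \<Longrightarrow> 0 \<le> x \<Longrightarrow> real k * x\<^sup>2 \<le> \<sigma>2 * y'\<^sup>2 \<Longrightarrow> c \<le> walk_tail x k" by blast
  define n0 where "n0 = max N1 N2"
  have n0: "n0 > 0" "N1 \<le> n0" "N2 \<le> n0" using N1(1) by (auto simp: n0_def)
  define K where "K = \<sigma>2 * (y\<^sup>2 - 1)"
  have K: "K > 0" using y \<sigma>2_pos by (simp add: K_def one_less_power)
  \<comment> \<open>The first bound keeps the rounding error \<open>\<epsilon>\<^sup>2\<close> of a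
    block below \<open>\<sigma>2\<close>; the second makes the block length at least
    \<open>n0\<close>.\<close>
  define \<epsilon>0 where "\<epsilon>0 = min (sqrt \<sigma>2) (sqrt (K / real n0))"
  have e0: "\<epsilon>0 > 0" using K \<sigma>2_pos n0 by (simp add: \<epsilon>0_def)
  show ?thesis
  proof (rule that[OF c0 e0, of n0])
    fix \<epsilon> k assume e: "0 < \<epsilon>" "\<epsilon> \<le> \<epsilon>0" and "n0 \<le> k"
    define \<kappa> where "\<kappa> = (1 + \<delta>) / (2 * \<sigma>2)"
    have \<kappa>: "\<kappa> > 0" using \<delta> \<sigma>2_pos by (simp add: \<kappa>_def)
    have e2: "\<epsilon>\<^sup>2 \<le> \<sigma>2" "\<epsilon>\<^sup>2 \<le> K / real n0"
      using e power_mono[of \<epsilon> "sqrt \<sigma>2" 2] power_mono[of \<epsilon> "sqrt (K / real n0)" 2] \<sigma>2_pos K n0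
      by (auto simp: \<epsilon>0_def)
    define b where "b = nat \<lceil>K / \<epsilon>\<^sup>2\<rceil>"
    have "K / \<epsilon>\<^sup>2 \<le> real b" "real b \<le> K / \<epsilon>\<^sup>2 + 1" using K e by (simp_all add: b_def)
    hence b: "K \<le> real b * \<epsilon>\<^sup>2" "real b * \<epsilon>\<^sup>2 \<le> K + \<epsilon>\<^sup>2" using e by (simp_all add: field_simps)
    have "real n0 * \<epsilon>\<^sup>2 \<le> real b * \<epsilon>\<^sup>2" using e2(2) n0 b(1) by (simp add: field_simps)
    hence nb: "n0 \<le> b" using e by simp
    have b2: "real b * \<epsilon>\<^sup>2 \<le> \<sigma>2 * y\<^sup>2" using b(2) e2(1) by (simp add: K_def algebra_simps)
    have eK: "exp (- (1 + \<delta>) * (y\<^sup>2 - 1) / 2) = exp (- \<kappa> * K)"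
      using \<sigma>2_pos by (simp add: \<kappa>_def K_def field_simps)
    have block: "exp (- \<kappa> * (real b * \<epsilon>\<^sup>2)) \<le> walk_tail \<epsilon> b"
    proof -
      have "exp (- \<kappa> * (real b * \<epsilon>\<^sup>2)) \<le> exp (- \<kappa> * K)" using b(1) \<kappa> by simp
      also have "\<dots> \<le> walk_tail \<epsilon> b" unfolding eK[symmetric] using N1(2)[of b \<epsilon>] b2 nb n0 e by simp
      finally show ?thesis .
    qed
    have "c * exp (- \<kappa> * (real k * \<epsilon>\<^sup>2)) \<le> walk_tail \<epsilon> k"
      using \<open>n0 \<le> k\<close>
    proof (induction k rule: less_induct)
      case (less k)
      show ?case
      \<comment> \<open>The cut at \<open>2 * b\<close> ensures that removing one block leaves a
        walk of length at least \<open>b \<ge> n0\<close>, to which the induction hypothesis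
        applies.\<close>
      proof (cases "k < 2 * b")
        case True
        have "real k * \<epsilon>\<^sup>2 \<le> real (2 * b) * \<epsilon>\<^sup>2" using True by (intro mult_right_mono) auto
        also have "\<dots> \<le> \<sigma>2 * y'\<^sup>2" using b2 by (simp add: y'_def power_mult_distrib)
        finally have "c \<le> walk_tail \<epsilon> k" using N2(2)[of k \<epsilon>] less.prems n0 e by simp
        moreover have "c * exp (- \<kappa> * (real k * \<epsilon>\<^sup>2)) \<le> c * 1"
          using c0 \<kappa> by (intro mult_left_mono) auto
        ultimately show ?thesis by simp
      next
        case False
        have bk: "b > 0" "b \<le> k" "n0 \<le> k - b" using False nb n0 by auto
        have "c * exp (- \<kappa> * (real k * \<epsilon>\<^sup>2)) = exp (- \<kappa> * (real b * \<epsilon>\<^sup>2)) * (c * exp (- \<kappa> * (real (k - b) * \<epsilon>\<^sup>2)))"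
          using bk by (simp add: of_nat_diff algebra_simps flip: exp_add)
        also have "\<dots> \<le> walk_tail \<epsilon> b * walk_tail \<epsilon> (k - b)"
          using block less.IH[of "k - b"] bk c0 walk_tail_bounds by (intro mult_mono) auto
        also have "\<dots> \<le> walk_tail \<epsilon> k" using walk_tail_supermult[of \<epsilon> b "k - b"] bk by simp
        finally show ?thesis .
      qed
    qed
    thus "c * exp (- ((1 + \<delta>) / (2 * \<sigma>2)) * \<epsilon>\<^sup>2) ^ k \<le> walk_tail \<epsilon> k"
      unfolding \<kappa>_def[symmetric] by (simp add: exp_of_nat_mult[symmetric] mult_ac)
  qed
qed

end

section \<open>Tails of the random-index average\<close>

locale GW_boettcher = GW_walk_exp +
  assumes p_int: "integrable (measure_pmf p) real" and p_mean: "1 < offspring_mean p"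
    and p_0: "pmf p 0 = 0" and p_1: "pmf p 1 = 0"
begin

abbreviation "W \<equiv> GW_limit xi (offspring_mean p)"

definition \<phi> :: "real \<Rightarrow> real" where "\<phi> h = expectation (\<lambda>\<omega>. exp (- h * W \<omega>))"

lemma W_measurable[measurable]: "W \<in> borel_measurable M"
  unfolding GW_limit_def[abs_def] by measurable

lemma W_nonneg: "AE \<omega> in M. 0 \<le> W \<omega>"
proof -
  have "AE \<omega> in M. (\<lambda>n. real (Z n \<omega>) / offspring_mean p ^ n) \<longlonglongrightarrow> W \<omega>"
    using p_mean by (intro GW_pop_limit[OF p_int]) simp
  thus ?thesis
    by eventually_elim (rule LIMSEQ_le_const, auto intro!: divide_nonneg_nonneg simp: offspring_mean_def)
qed

lemma laplace_integrable: "0 \<le> h \<Longrightarrow> integrable M (\<lambda>\<omega>. exp (- h * W \<omega>))"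
  by (rule integrable_const_bound[where B=1]) (use W_nonneg in \<open>auto elim!: eventually_mono\<close>)

lemma laplace_range: assumes "0 \<le> h" shows "\<phi> h \<in> {0<..1}"
proof -
  have "\<phi> h \<le> expectation (\<lambda>_. 1)" unfolding \<phi>_def
    by (rule integral_mono_AE[OF laplace_integrable[OF assms]])
       (use W_nonneg assms in \<open>auto elim!: eventually_mono\<close>)
  moreover have "0 < \<phi> h" unfolding \<phi>_def
    by (rule expectation_greater[OF laplace_integrable[OF assms]]) auto
  ultimately show ?thesis by (simp add: prob_space)
qed

lemma laplace_tendsto:
  assumes "u \<longlonglongrightarrow> h" "\<And>n. 0 \<le> u n" shows "(\<lambda>n. \<phi> (u n)) \<longlonglongrightarrow> \<phi> h"
  unfolding \<phi>_def
proof (rule integral_dominated_convergence[where w="\<lambda>_. 1"])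
  show "AE \<omega> in M. (\<lambda>n. exp (- u n * W \<omega>)) \<longlonglongrightarrow> exp (- h * W \<omega>)"
    by (intro AE_I2 tendsto_intros assms)
  show "AE \<omega> in M. norm (exp (- u n * W \<omega>)) \<le> 1" for n
    using W_nonneg assms(2)[of n] by (auto elim!: eventually_mono)
qed auto

text \<open>The iterate is the Laplace transform of \<open>Z j / m ^ j\<close> at
  \<open>\<theta>\<close>, so almost sure convergence and bounded convergence give the
  limit.\<close>

lemma iterate_tendsto_laplace:
  assumes "\<theta> > 0"
  shows "(\<lambda>j. (offspring_gf p ^^ j) (exp (- \<theta> / offspring_mean p ^ j))) \<longlonglongrightarrow> \<phi> \<theta>"
proof -
  have m: "0 < offspring_mean p" using p_mean by simp
  have eq: "(offspring_gf p ^^ j) (exp (- \<theta> / offspring_mean p ^ j)) =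
    expectation (\<lambda>\<omega>. exp (- \<theta> * (real (Z j \<omega>) / offspring_mean p ^ j)))" for j
    using assms m
    by (subst expectation_power_GW_pop[symmetric]) (auto simp: exp_of_nat_mult[symmetric] field_simps intro!: Bochner_Integration.integral_cong)
  show ?thesis unfolding eq \<phi>_def
  proof (rule integral_dominated_convergence[where w="\<lambda>_. 1"])
    show "AE \<omega> in M. (\<lambda>j. exp (- \<theta> * (real (Z j \<omega>) / offspring_mean p ^ j))) \<longlonglongrightarrow> exp (- \<theta> * W \<omega>)"
      using GW_pop_limit[OF p_int m] by eventually_elim (intro tendsto_intros)
    show "AE \<omega> in M. norm (exp (- \<theta> * (real (Z j \<omega>) / offspring_mean p ^ j))) \<le> 1" for j
      using assms m by auto
  qed auto
qed

sublocale boettcher_limit p \<phi>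
  by unfold_locales (use p_0 p_1 p_mean iterate_tendsto_laplace laplace_range in auto)

text \<open>The two powers in the theorem are merged into one, to share the denominator of
  \<open>normalized_log_gf\<close> with \<open>a n = (\<epsilon> n)\<^sup>2\<close>.\<close>

definition normalized_log_tail :: "(nat \<Rightarrow> real) \<Rightarrow> nat \<Rightarrow> real" where
  "normalized_log_tail \<epsilon> n = ln (R_tail M xi X n (\<epsilon> n)) / ((\<epsilon> n)\<^sup>2 * m ^ n) powr \<beta>"

lemma GW_pop_pos: "AE \<omega> in M. 0 < Z n \<omega>"
  using GW_pop_ge[OF p_0 p_1] by eventually_elim (metis less_le_trans zero_less_Suc)

lemma walk_tail_GW_integrable: "integrable M (\<lambda>\<omega>. walk_tail x (Z n \<omega>))"
  by (intro integrable_const_bound[where B=1] measurable_compose[OF GW_pop_measurable])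
     (auto simp: walk_tail_bounds)

lemma power_GW_integrable: "0 \<le> s \<Longrightarrow> s \<le> 1 \<Longrightarrow> integrable M (\<lambda>\<omega>. s ^ Z n \<omega> :: real)"
  by (intro integrable_const_bound[where B=1] measurable_compose[OF GW_pop_measurable])
     (auto simp: power_le_one)

text \<open>The constant factor of \<open>walk_tail_lower\<close> becomes the additive term with
  \<open>C = ln c\<close>, which fades in the limit. Positivity of the tail is recorded because
  comparing logarithms requires it.\<close>

lemma normalized_log_tail_lower:
  assumes pos: "\<And>n. \<epsilon> n > 0" and lim: "\<epsilon> \<longlonglongrightarrow> 0" and \<delta>: "\<delta> > 0"
  obtains C where "\<forall>\<^sub>F n in sequentially. 0 < R_tail M xi X n (\<epsilon> n) \<and>
      normalized_log_gf ((1 + \<delta>) / (2 * \<sigma>2)) (\<lambda>n. (\<epsilon> n)\<^sup>2) n + C / ((\<epsilon> n)\<^sup>2 * m ^ n) powr \<beta> \<le> normalized_log_tail \<epsilon> n"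
proof -
  obtain c \<epsilon>0 n0 where c: "c > 0" "\<epsilon>0 > 0"
    "\<And>\<epsilon> k. 0 < \<epsilon> \<Longrightarrow> \<epsilon> \<le> \<epsilon>0 \<Longrightarrow> n0 \<le> k \<Longrightarrow> c * exp (- ((1 + \<delta>) / (2 * \<sigma>2)) * \<epsilon>\<^sup>2) ^ k \<le> walk_tail \<epsilon> k"
    using walk_tail_lower[OF \<delta>] by blast
  \<comment> \<open>From \<open>n \<ge> n0\<close> on, \<open>Z n \<ge> Suc n\<close> almost surely
    exceeds the threshold of the walk estimate.\<close>
  from order_tendstoD(2)[OF lim c(2)] eventually_ge_at_top[of n0]
  have "\<forall>\<^sub>F n in sequentially. 0 < R_tail M xi X n (\<epsilon> n) \<and>
      normalized_log_gf ((1 + \<delta>) / (2 * \<sigma>2)) (\<lambda>n. (\<epsilon> n)\<^sup>2) n + ln c / ((\<epsilon> n)\<^sup>2 * m ^ n) powr \<beta> \<le> normalized_log_tail \<epsilon> n"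
  proof eventually_elim
    case (elim n)
    define s where "s = exp (- ((1 + \<delta>) / (2 * \<sigma>2)) * (\<epsilon> n)\<^sup>2)"
    have s: "s \<in> {0<..1}" using \<delta> \<sigma>2_pos by (simp add: s_def)
    have F: "0 < (f ^^ n) s" using iterate_in[OF s, of n] by simp
    have "c * (f ^^ n) s = expectation (\<lambda>\<omega>. c * s ^ Z n \<omega>)"
      using s by (simp add: expectation_power_GW_pop)
    also have "\<dots> \<le> expectation (\<lambda>\<omega>. walk_tail (\<epsilon> n) (Z n \<omega>))"
    proof (rule integral_mono_AE)
      show "AE \<omega> in M. c * s ^ Z n \<omega> \<le> walk_tail (\<epsilon> n) (Z n \<omega>)"
        using GW_pop_ge[OF p_0 p_1]
      proof eventually_elim
        case (elim \<omega>)
        have "n0 \<le> Z n \<omega>" using elim[rule_format, of n] \<open>n0 \<le> n\<close> by simp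
        thus ?case unfolding s_def using pos[of n] \<open>\<epsilon> n < \<epsilon>0\<close> by (intro c(3)) auto
      qed
    qed (use s in \<open>auto intro: walk_tail_GW_integrable power_GW_integrable\<close>)
    also have "\<dots> = R_tail M xi X n (\<epsilon> n)" by (rule R_tail_eq[OF GW_pop_pos, symmetric])
    finally have R: "c * (f ^^ n) s \<le> R_tail M xi X n (\<epsilon> n)" .
    have cF: "0 < c * (f ^^ n) s" using F c(1) by simp
    hence "ln (c * (f ^^ n) s) \<le> ln (R_tail M xi X n (\<epsilon> n))" using R by (subst ln_le_cancel_iff) auto
    hence "ln ((f ^^ n) s) + ln c \<le> ln (R_tail M xi X n (\<epsilon> n))" using F c(1) by (simp add: ln_mult)
    from divide_right_mono[OF this, of "((\<epsilon> n)\<^sup>2 * m ^ n) powr \<beta>"] show ?case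
      using R cF by (auto simp: normalized_log_gf_def normalized_log_tail_def s_def add_divide_distrib)
  qed
  thus ?thesis by (rule that)
qed

lemma normalized_log_tail_upper:
  assumes pos: "\<And>n. \<epsilon> n > 0" and lim: "\<epsilon> \<longlonglongrightarrow> 0" and \<delta>: "\<delta> > 0" "\<delta> < 1"
  shows "\<forall>\<^sub>F n in sequentially.
      normalized_log_tail \<epsilon> n \<le> normalized_log_gf ((1 - \<delta>) / (2 * \<sigma>2)) (\<lambda>n. (\<epsilon> n)\<^sup>2) n"
proof -
  obtain \<epsilon>0 where e0: "\<epsilon>0 > 0"
    "\<And>\<epsilon> j. 0 < \<epsilon> \<Longrightarrow> \<epsilon> \<le> \<epsilon>0 \<Longrightarrow> walk_tail \<epsilon> j \<le> exp (- ((1 - \<delta>) / (2 * \<sigma>2)) * \<epsilon>\<^sup>2) ^ j"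
    using walk_tail_upper[OF \<delta>(1)] by blast
  \<comment> \<open>The lower bound is invoked for the positivity of the tail, without which its
    logarithm could not be compared.\<close>
  obtain C where "\<forall>\<^sub>F n in sequentially. 0 < R_tail M xi X n (\<epsilon> n) \<and>
      normalized_log_gf ((1 + \<delta>) / (2 * \<sigma>2)) (\<lambda>n. (\<epsilon> n)\<^sup>2) n + C / ((\<epsilon> n)\<^sup>2 * m ^ n) powr \<beta> \<le> normalized_log_tail \<epsilon> n"
    by (rule normalized_log_tail_lower[of \<epsilon>, OF pos lim \<delta>(1)])
  with order_tendstoD(2)[OF lim e0(1)] show ?thesis
  proof eventually_elim
    case (elim n)
    define s where "s = exp (- ((1 - \<delta>) / (2 * \<sigma>2)) * (\<epsilon> n)\<^sup>2)"
    have s: "s \<in> {0<..1}" using \<delta> \<sigma>2_pos by (simp add: s_def)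
    have "R_tail M xi X n (\<epsilon> n) = expectation (\<lambda>\<omega>. walk_tail (\<epsilon> n) (Z n \<omega>))"
      by (rule R_tail_eq[OF GW_pop_pos])
    also have "\<dots> \<le> expectation (\<lambda>\<omega>. s ^ Z n \<omega>)"
      unfolding s_def using s pos[of n] elim
      by (intro integral_mono walk_tail_GW_integrable power_GW_integrable e0(2)) (auto simp: s_def)
    also have "\<dots> = (f ^^ n) s" using s by (simp add: expectation_power_GW_pop)
    finally have "ln (R_tail M xi X n (\<epsilon> n)) \<le> ln ((f ^^ n) s)"
      using elim by (subst ln_le_cancel_iff) auto
    from divide_right_mono[OF this, of "((\<epsilon> n)\<^sup>2 * m ^ n) powr \<beta>"] show ?case
      by (simp add: normalized_log_gf_def normalized_log_tail_def s_def)
  qed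
qed

section \<open>Passage to the limit in \<open>n\<close>, then in \<open>\<delta>\<close>\<close>

definition L :: real where "L = ln (boettcher_B p (\<phi> (1 / (2 * \<sigma>2))))"

lemma L_continuity:
  assumes "u \<longlonglongrightarrow> 1" "\<And>n. 0 < u n"
  shows "(\<lambda>n. ln (boettcher_B p (\<phi> (u n / (2 * \<sigma>2))))) \<longlonglongrightarrow> L"
  unfolding L_def
proof (rule continuous_on_tendsto_compose[OF ln_boettcher_continuous])
  show "(\<lambda>n. \<phi> (u n / (2 * \<sigma>2))) \<longlonglongrightarrow> \<phi> (1 / (2 * \<sigma>2))"
    using assms \<sigma>2_pos by (intro laplace_tendsto tendsto_intros) (auto simp: less_imp_le)
qed (use assms \<sigma>2_pos in \<open>auto intro!: laplace_range always_eventually simp: less_imp_le simp del: greaterThanAtMost_iff\<close>)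

text \<open>Stated with a factor \<open>K\<close> to serve both claims: \<open>K = \<mu>\<close> for
  general \<open>\<epsilon>\<close>, \<open>K = 1\<close> when \<open>(\<epsilon> n)\<^sup>2\<close>
  is an exact power of \<open>m\<close>. In the limsup counterpart \<open>K\<close> is a
  divisor.\<close>

lemma liminf_normalized_log_tail:
  assumes pos: "\<And>n. \<epsilon> n > 0" and lim: "\<epsilon> \<longlonglongrightarrow> 0"
    and inf: "filterlim (\<lambda>n. (\<epsilon> n)\<^sup>2 * m ^ n) at_top sequentially"
    and lower: "\<And>\<theta>. \<theta> > 0 \<Longrightarrow> \<exists>y. y \<longlonglongrightarrow> K * ln (boettcher_B p (\<phi> \<theta>)) \<and>
      (\<forall>\<^sub>F n in sequentially. y n \<le> normalized_log_gf \<theta> (\<lambda>n. (\<epsilon> n)\<^sup>2) n)"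
  shows "ereal (K * L) \<le> liminf (\<lambda>n. ereal (normalized_log_tail \<epsilon> n))"
proof -
  have le: "ereal (K * ln (boettcher_B p (\<phi> ((1 + \<delta>) / (2 * \<sigma>2))))) \<le> liminf (\<lambda>n. ereal (normalized_log_tail \<epsilon> n))"
    if \<delta>: "\<delta> > 0" for \<delta>
  proof -
    have "(1 + \<delta>) / (2 * \<sigma>2) > 0" using \<delta> \<sigma>2_pos by simp
    then obtain y where y: "y \<longlonglongrightarrow> K * ln (boettcher_B p (\<phi> ((1 + \<delta>) / (2 * \<sigma>2))))"
      "\<forall>\<^sub>F n in sequentially. y n \<le> normalized_log_gf ((1 + \<delta>) / (2 * \<sigma>2)) (\<lambda>n. (\<epsilon> n)\<^sup>2) n" using lower by blast
    obtain C where C: "\<forall>\<^sub>F n in sequentially. 0 < R_tail M xi X n (\<epsilon> n) \<and>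
      normalized_log_gf ((1 + \<delta>) / (2 * \<sigma>2)) (\<lambda>n. (\<epsilon> n)\<^sup>2) n + C / ((\<epsilon> n)\<^sup>2 * m ^ n) powr \<beta> \<le> normalized_log_tail \<epsilon> n"
      by (rule normalized_log_tail_lower[of \<epsilon>, OF pos lim \<delta>])
    have "((\<lambda>x. C / x powr \<beta>) \<longlongrightarrow> 0) at_top" using boettcher_const_pos by real_asymp
    from tendsto_add[OF y(1) filterlim_compose[OF this inf]]
    have "(\<lambda>n. ereal (y n + C / ((\<epsilon> n)\<^sup>2 * m ^ n) powr \<beta>)) \<longlonglongrightarrow> ereal (K * ln (boettcher_B p (\<phi> ((1 + \<delta>) / (2 * \<sigma>2)))))"
      by simp
    from lim_imp_Liminf[OF _ this]
    have "ereal (K * ln (boettcher_B p (\<phi> ((1 + \<delta>) / (2 * \<sigma>2))))) = liminf (\<lambda>n. ereal (y n + C / ((\<epsilon> n)\<^sup>2 * m ^ n) powr \<beta>))"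
      by simp
    also have "\<dots> \<le> liminf (\<lambda>n. ereal (normalized_log_tail \<epsilon> n))"
      by (rule Liminf_mono) (use y(2) C in eventually_elim, simp)
    finally show ?thesis .
  qed
  \<comment> \<open>The liminf does not involve \<open>\<delta>\<close>, so
    \<open>\<delta> = 1 / Suc k\<close> may now tend to 0.\<close>
  have "(\<lambda>k. K * ln (boettcher_B p (\<phi> ((1 + 1 / real (Suc k)) / (2 * \<sigma>2))))) \<longlonglongrightarrow> K * L"
    by (intro tendsto_intros L_continuity) (real_asymp, simp add: add_pos_pos)
  hence "(\<lambda>k. ereal (K * ln (boettcher_B p (\<phi> ((1 + 1 / real (Suc k)) / (2 * \<sigma>2)))))) \<longlonglongrightarrow> ereal (K * L)" by simp
  thus ?thesis by (rule LIMSEQ_le_const2) (use le in auto)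
qed

lemma limsup_normalized_log_tail:
  assumes pos: "\<And>n. \<epsilon> n > 0" and lim: "\<epsilon> \<longlonglongrightarrow> 0"
    and upper: "\<And>\<theta>. \<theta> > 0 \<Longrightarrow> \<exists>x. x \<longlonglongrightarrow> ln (boettcher_B p (\<phi> \<theta>)) / K \<and>
      (\<forall>\<^sub>F n in sequentially. normalized_log_gf \<theta> (\<lambda>n. (\<epsilon> n)\<^sup>2) n \<le> x n)" and K: "K \<noteq> 0"
  shows "limsup (\<lambda>n. ereal (normalized_log_tail \<epsilon> n)) \<le> ereal (L / K)"
proof -
  have le: "limsup (\<lambda>n. ereal (normalized_log_tail \<epsilon> n)) \<le> ereal (ln (boettcher_B p (\<phi> ((1 - \<delta>) / (2 * \<sigma>2)))) / K)"
    if \<delta>: "\<delta> > 0" "\<delta> < 1" for \<delta>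
  proof -
    have "(1 - \<delta>) / (2 * \<sigma>2) > 0" using \<delta> \<sigma>2_pos by simp
    then obtain x where x: "x \<longlonglongrightarrow> ln (boettcher_B p (\<phi> ((1 - \<delta>) / (2 * \<sigma>2)))) / K"
      "\<forall>\<^sub>F n in sequentially. normalized_log_gf ((1 - \<delta>) / (2 * \<sigma>2)) (\<lambda>n. (\<epsilon> n)\<^sup>2) n \<le> x n" using upper by blast
    have "limsup (\<lambda>n. ereal (normalized_log_tail \<epsilon> n)) \<le> limsup (\<lambda>n. ereal (x n))"
      by (rule Limsup_mono) (use x(2) normalized_log_tail_upper[of \<epsilon>, OF pos lim \<delta>] in eventually_elim, simp)
    also have "\<dots> = ereal (ln (boettcher_B p (\<phi> ((1 - \<delta>) / (2 * \<sigma>2)))) / K)"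
      by (rule lim_imp_Limsup) (use x(1) in auto)
    finally show ?thesis .
  qed
  \<comment> \<open>The shift \<open>k + 2\<close> keeps \<open>\<delta>\<close> strictly below
    1.\<close>
  have "(\<lambda>k. ln (boettcher_B p (\<phi> ((1 - 1 / real (k + 2)) / (2 * \<sigma>2)))) / K) \<longlonglongrightarrow> L / K"
    using K by (intro tendsto_intros L_continuity) (real_asymp, simp)
  hence "(\<lambda>k. ereal (ln (boettcher_B p (\<phi> ((1 - 1 / real (k + 2)) / (2 * \<sigma>2)))) / K)) \<longlonglongrightarrow> ereal (L / K)" by simp
  thus ?thesis by (rule LIMSEQ_le_const) (use le in auto)
qed

theorem normalized_log_tail_bounds:
  assumes pos: "\<And>n. \<epsilon> n > 0" and lim: "\<epsilon> \<longlonglongrightarrow> 0"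
    and inf: "filterlim (\<lambda>n. (\<epsilon> n)\<^sup>2 * m ^ n) at_top sequentially"
  shows "\<forall>\<^sub>F n in sequentially. 0 < R_tail M xi X n (\<epsilon> n)"
    and "ereal (real \<mu> * L) \<le> liminf (\<lambda>n. ereal (normalized_log_tail \<epsilon> n))"
    and "limsup (\<lambda>n. ereal (normalized_log_tail \<epsilon> n)) \<le> ereal (L / real \<mu>)"
proof -
  obtain C where "\<forall>\<^sub>F n in sequentially. 0 < R_tail M xi X n (\<epsilon> n) \<and>
    normalized_log_gf ((1 + 1) / (2 * \<sigma>2)) (\<lambda>n. (\<epsilon> n)\<^sup>2) n + C / ((\<epsilon> n)\<^sup>2 * m ^ n) powr \<beta> \<le> normalized_log_tail \<epsilon> n"
    by (rule normalized_log_tail_lower[of \<epsilon>, OF pos lim zero_less_one])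
  thus "\<forall>\<^sub>F n in sequentially. 0 < R_tail M xi X n (\<epsilon> n)" by eventually_elim simp
  have sq: "(\<epsilon> n)\<^sup>2 > 0" for n using pos[of n] by simp
  have sq0: "(\<lambda>n. (\<epsilon> n)\<^sup>2) \<longlonglongrightarrow> 0" using tendsto_power[OF lim, of 2] by simp
  have gf: "\<exists>x y. y \<longlonglongrightarrow> real \<mu> * ln (boettcher_B p (\<phi> \<theta>)) \<and> x \<longlonglongrightarrow> ln (boettcher_B p (\<phi> \<theta>)) / real \<mu> \<and>
    (\<forall>\<^sub>F n in sequentially. y n \<le> normalized_log_gf \<theta> (\<lambda>n. (\<epsilon> n)\<^sup>2) n) \<and>
    (\<forall>\<^sub>F n in sequentially. normalized_log_gf \<theta> (\<lambda>n. (\<epsilon> n)\<^sup>2) n \<le> x n)" if "\<theta> > 0" for \<theta>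
    by (rule normalized_log_gf_bounds[OF that sq sq0 inf]) blast
  show "ereal (real \<mu> * L) \<le> liminf (\<lambda>n. ereal (normalized_log_tail \<epsilon> n))"
    by (rule liminf_normalized_log_tail[OF pos lim inf]) (use gf in blast)
  show "limsup (\<lambda>n. ereal (normalized_log_tail \<epsilon> n)) \<le> ereal (L / real \<mu>)"
    by (rule limsup_normalized_log_tail[OF pos lim]) (use gf in blast, use index_ge_2 in simp)
qed

theorem normalized_log_tail_limit:
  assumes pos: "\<And>n. \<epsilon> n > 0" and lim: "\<epsilon> \<longlonglongrightarrow> 0"
    and inf: "filterlim (\<lambda>n. (\<epsilon> n)\<^sup>2 * m ^ n) at_top sequentially"
    and lam: "\<And>n. \<epsilon> n = m powr (- real_of_int (lam n) / 2)" "filterlim lam at_top sequentially"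
  shows "normalized_log_tail \<epsilon> \<longlonglongrightarrow> L"
proof -
  define j where "j n = nat (lam n)" for n
  have m0: "m > 0" using mean_gt_1 by simp
  have sq: "(\<epsilon> n)\<^sup>2 = m powr (- real_of_int (lam n))" for n
    using m0 by (simp add: lam(1) power2_eq_square flip: powr_add)
  have lam0: "\<forall>\<^sub>F n in sequentially. 0 \<le> lam n" using lam(2) unfolding filterlim_at_top by blast
  have j1: "filterlim j at_top sequentially"
    unfolding filterlim_at_top
  proof
    fix Z :: nat
    have "\<forall>\<^sub>F n in sequentially. int Z \<le> lam n" using lam(2) unfolding filterlim_at_top by blast
    thus "\<forall>\<^sub>F n in sequentially. Z \<le> j n" by eventually_elim (simp add: j_def)
  qed
  have j2: "filterlim (\<lambda>n. n - j n) at_top sequentially"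
    unfolding filterlim_at_top
  proof
    fix Z :: nat
    \<comment> \<open>The growth of \<open>n - j n\<close> is read off from \<open>inf\<close>: the
      product \<open>(\<epsilon> n)\<^sup>2 * m ^ n\<close> is \<open>m\<close> to the power
      \<open>n - lam n\<close>.\<close>
    have "\<forall>\<^sub>F n in sequentially. m ^ Z \<le> (\<epsilon> n)\<^sup>2 * m ^ n" using inf unfolding filterlim_at_top by blast
    with lam0 show "\<forall>\<^sub>F n in sequentially. Z \<le> n - j n"
    proof eventually_elim
      case (elim n)
      have "m powr real Z \<le> m powr (real n - real_of_int (lam n))"
        using elim(2) m0 by (simp add: sq powr_realpow[symmetric] powr_add[symmetric])
      hence "real Z \<le> real n - real_of_int (lam n)" using mean_gt_1 by simp
      thus ?case using elim(1) by (simp add: j_def)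
    qed
  qed
  have a: "\<forall>\<^sub>F n in sequentially. (\<epsilon> n)\<^sup>2 = 1 / m ^ j n"
    using lam0 by eventually_elim (simp add: sq j_def powr_minus divide_inverse m0 powr_realpow[symmetric])
  have gf: "normalized_log_gf \<theta> (\<lambda>n. (\<epsilon> n)\<^sup>2) \<longlonglongrightarrow> ln (boettcher_B p (\<phi> \<theta>))" if "\<theta> > 0" for \<theta>
    by (rule normalized_log_gf_limit[OF that j1 j2 a])
  have "ereal (1 * L) \<le> liminf (\<lambda>n. ereal (normalized_log_tail \<epsilon> n))"
    by (rule liminf_normalized_log_tail[OF pos lim inf])
       (auto intro!: exI[of _ "normalized_log_gf _ (\<lambda>n. (\<epsilon> n)\<^sup>2)"] gf)
  moreover have "limsup (\<lambda>n. ereal (normalized_log_tail \<epsilon> n)) \<le> ereal (L / 1)"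
    by (rule limsup_normalized_log_tail[OF pos lim])
       (auto intro!: exI[of _ "normalized_log_gf _ (\<lambda>n. (\<epsilon> n)\<^sup>2)"] gf)
  moreover have "liminf (\<lambda>n. ereal (normalized_log_tail \<epsilon> n)) \<le> limsup (\<lambda>n. ereal (normalized_log_tail \<epsilon> n))"
    by (simp add: Liminf_le_Limsup)
  ultimately have "(\<lambda>n. ereal (normalized_log_tail \<epsilon> n)) \<longlonglongrightarrow> ereal L"
    by (intro Liminf_eq_Limsup) auto
  thus ?thesis by simp
qed

end

theorem theorem3:
  fixes M :: "'a measure" and p :: "nat pmf"
    and xi :: "nat \<Rightarrow> nat \<Rightarrow> 'a \<Rightarrow> nat" and X :: "nat \<Rightarrow> 'a \<Rightarrow> real"
  assumes "prob_space M"
    and "\<And>n i. xi n i \<in> measurable M (count_space UNIV)"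
    and "\<And>n i. distr M (count_space UNIV) (xi n i) = measure_pmf p"
    and "\<And>j. X j \<in> borel_measurable M"
    and "\<And>j. distr M borel (X j) = distr M borel (X 0)"
    and "prob_space.indep_vars M (\<lambda>_. borel)
           (\<lambda>(i :: (nat \<times> nat) + nat) \<omega>. case i of Inl (n, k) \<Rightarrow> real (xi n k \<omega>) | Inr j \<Rightarrow> X j \<omega>) UNIV"
    and "integrable (measure_pmf p) real"
    and "offspring_mean p > 1"
    and "integrable (measure_pmf p) (\<lambda>k. real k * ln (real k))"
    and "pmf p 0 = 0" and "pmf p 1 = 0"
    and "integrable M (\<lambda>\<omega>. (X 0 \<omega>)\<^sup>2)"
    and "integral\<^sup>L M (X 0) = 0"
    and "integral\<^sup>L M (\<lambda>\<omega>. (X 0 \<omega>)\<^sup>2) > 0"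
    and "\<exists>h>0. integrable M (\<lambda>\<omega>. exp (h * \<bar>X 0 \<omega>\<bar>))"
  defines "m \<equiv> offspring_mean p"
    and "\<mu> \<equiv> real (boettcher_index p)"
    and "\<beta> \<equiv> boettcher_const p"
    and "\<sigma>2 \<equiv> integral\<^sup>L M (\<lambda>\<omega>. (X 0 \<omega>)\<^sup>2)"
    and "\<phi> \<equiv> (\<lambda>h. integral\<^sup>L M (\<lambda>\<omega>. exp (- h * GW_limit xi (offspring_mean p) \<omega>)))"
    and "L \<equiv> ln (boettcher_B p (integral\<^sup>L M (\<lambda>\<omega>.
              exp (- (1 / (2 * integral\<^sup>L M (\<lambda>\<omega>'. (X 0 \<omega>')\<^sup>2))) * GW_limit xi (offspring_mean p) \<omega>))))"
    and "a \<equiv> (\<lambda>(\<epsilon> :: nat \<Rightarrow> real) n. \<epsilon> n powr (- 2 * boettcher_const p) * offspring_mean p powr (- boettcher_const p * real n)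
                 * ln (R_tail M xi X n (\<epsilon> n)))"
  shows "(\<forall>\<epsilon> :: nat \<Rightarrow> real.
            (\<forall>n. \<epsilon> n > 0) \<and> \<epsilon> \<longlonglongrightarrow> 0 \<and>
            filterlim (\<lambda>n. (\<epsilon> n)\<^sup>2 * m ^ n) at_top sequentially \<longrightarrow>
              eventually (\<lambda>n. R_tail M xi X n (\<epsilon> n) > 0) sequentially \<and>
              ereal (\<mu> * L) \<le> liminf (\<lambda>n. ereal (a \<epsilon> n)) \<and>
              liminf (\<lambda>n. ereal (a \<epsilon> n)) \<le> limsup (\<lambda>n. ereal (a \<epsilon> n)) \<and>
              limsup (\<lambda>n. ereal (a \<epsilon> n)) \<le> ereal (L / \<mu>))
       \<and> (\<forall>(\<epsilon> :: nat \<Rightarrow> real) (lam :: nat \<Rightarrow> int).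
            (\<forall>n. \<epsilon> n > 0) \<and> \<epsilon> \<longlonglongrightarrow> 0 \<and>
            filterlim (\<lambda>n. (\<epsilon> n)\<^sup>2 * m ^ n) at_top sequentially \<and>
            (\<forall>n. \<epsilon> n = m powr (- real_of_int (lam n) / 2)) \<and>
            filterlim lam at_top sequentially \<and>
            (\<lambda>n. real_of_int (lam n) / real n) \<longlonglongrightarrow> 0 \<longrightarrow>
              (\<lambda>n. a \<epsilon> n) \<longlonglongrightarrow> L)"
proof -
  have gw: "GW_boettcher M p xi X"
    using assms(1-15) by (simp add: GW_boettcher_def GW_boettcher_axioms_def GW_walk_exp_def
        GW_walk_exp_axioms_def GW_walk_def GW_walk_axioms_def)
  hence gw': "GW_walk_exp M p xi X" by (rule GW_boettcher.axioms)
  have L_eq: "GW_boettcher.L M p xi X = L"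
    unfolding L_def GW_boettcher.L_def[OF gw] GW_boettcher.\<phi>_def[OF gw] GW_walk_exp.\<sigma>2_def[OF gw'] ..
  have m0: "0 < m" using assms(8) by (simp add: m_def)
  have a_eq: "GW_boettcher.normalized_log_tail M p xi X \<epsilon> n = a \<epsilon> n" if "\<epsilon> n > 0" for \<epsilon> n
  proof -
    have "((\<epsilon> n)\<^sup>2 * m ^ n) powr \<beta> = \<epsilon> n powr (2 * \<beta>) * m powr (\<beta> * real n)"
      using that m0 by (simp add: powr_mult powr_powr mult.commute flip: powr_realpow powr_numeral)
    thus ?thesis
      unfolding GW_boettcher.normalized_log_tail_def[OF gw] a_def m_def[symmetric] \<beta>_def[symmetric]
      by (simp add: powr_minus divide_inverse)
  qed
  note bounds = GW_boettcher.normalized_log_tail_bounds[OF gw, folded m_def \<mu>_def, unfolded L_eq]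
    and limit = GW_boettcher.normalized_log_tail_limit[OF gw, folded m_def, unfolded L_eq]
  have part1: "eventually (\<lambda>n. R_tail M xi X n (\<epsilon> n) > 0) sequentially \<and>
      ereal (\<mu> * L) \<le> liminf (\<lambda>n. ereal (a \<epsilon> n)) \<and>
      liminf (\<lambda>n. ereal (a \<epsilon> n)) \<le> limsup (\<lambda>n. ereal (a \<epsilon> n)) \<and>
      limsup (\<lambda>n. ereal (a \<epsilon> n)) \<le> ereal (L / \<mu>)"
    if "\<forall>n. \<epsilon> n > 0" "\<epsilon> \<longlonglongrightarrow> 0" "filterlim (\<lambda>n. (\<epsilon> n)\<^sup>2 * m ^ n) at_top sequentially" for \<epsilon>
    using bounds[OF that(1)[rule_format] that(2,3)] a_eq[of \<epsilon>] that(1)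
    by (simp add: Liminf_le_Limsup)
  have part2: "(\<lambda>n. a \<epsilon> n) \<longlonglongrightarrow> L"
    if "\<forall>n. \<epsilon> n > 0" "\<epsilon> \<longlonglongrightarrow> 0" "filterlim (\<lambda>n. (\<epsilon> n)\<^sup>2 * m ^ n) at_top sequentially"
      "\<forall>n. \<epsilon> n = m powr (- real_of_int (lam n) / 2)" "filterlim lam at_top sequentially" for \<epsilon> lam
  proof -
    have "GW_boettcher.normalized_log_tail M p xi X \<epsilon> = a \<epsilon>" using a_eq[of \<epsilon>] that(1) by (intro ext) simp
    thus ?thesis
      using limit[OF that(1)[rule_format] that(2,3) that(4)[rule_format] that(5)] by simp
  qed
  show ?thesis using part1 part2 by blast
qed

end
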